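(* If $G$ is an $n$-vertex $2$-connected chordal graph, then $\mathrm{lct}(G)\le 4(1+\lfloor \lg n\rfloor)$.
   Context: All graphs are finite and simple. $\lg x$ denotes $\log_2 x$. A graph is chordal if each of its cycles on at least $4$ vertices has a chord. A graph $G$ is $k$-connected if $|V(G)|>k$ and $G-S$ is connected for all $S\subseteq V(G)$ with $|S|<k$. A longest cycle transversal in $G$ is a set of vertices of $G$ that intersects (the vertex set of) every longest cycle in $G$, where a longest cycle is a cycle of maximum length in $G$. $\mathrm{lct}(G)$ is the minimum size of a longest cycle transversal of $G$. *)

theory Defs
  imports Complex_Main "Graph_Theory.Graph_Theory"
begin

text \<open>
  A finite simple graph is a digraph satisfying the locale predicate \<^const>\<open>graph\<close>: finite,
  without loops or parallel arcs, and symmetric, so that an edge is a pair of opposite arcs.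
  The definitions below are meant for such digraphs.
\<close>

text \<open>
  A single edge traversed back and forth satisfies \<^const>\<open>pre_digraph.cycle\<close>; the
  bound on the length excludes it. In a graph without loops or parallel arcs the other cycles
  are those of the undirected graph, each given with a starting point and an orientation.
\<close>

definition graph_cycle :: "('a, 'b) pre_digraph \<Rightarrow> 'b list \<Rightarrow> bool" where
  "graph_cycle G p \<longleftrightarrow> pre_digraph.cycle G p \<and> 3 \<le> length p"

definition cycle_verts :: "('a, 'b) pre_digraph \<Rightarrow> 'b list \<Rightarrow> 'a set" where
  "cycle_verts G p = tail G ` set p"

definition has_chord :: "('a, 'b) pre_digraph \<Rightarrow> 'b list \<Rightarrow> bool" where
  "has_chord G p \<longleftrightarrow>
     (\<exists>u\<in>cycle_verts G p. \<exists>v\<in>cycle_verts G p. u \<rightarrow>\<^bsub>G\<^esub> v \<and>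
        (u, v) \<notin> arc_to_ends G ` set p \<and> (v, u) \<notin> arc_to_ends G ` set p)"

definition chordal :: "('a, 'b) pre_digraph \<Rightarrow> bool" where
  "chordal G \<longleftrightarrow>
     (\<forall>p. graph_cycle G p \<and> 4 \<le> card (cycle_verts G p) \<longrightarrow> has_chord G p)"

definition k_connected :: "nat \<Rightarrow> ('a, 'b) pre_digraph \<Rightarrow> bool" where
  "k_connected k G \<longleftrightarrow> k < card (verts G) \<and>
     (\<forall>S. S \<subseteq> verts G \<and> card S < k \<longrightarrow> connected (G \<restriction> (verts G - S)))"

definition longest_cycle :: "('a, 'b) pre_digraph \<Rightarrow> 'b list \<Rightarrow> bool" where
  "longest_cycle G p \<longleftrightarrow>
     graph_cycle G p \<and> (\<forall>q. graph_cycle G q \<longrightarrow> length q \<le> length p)"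

definition longest_cycle_transversal :: "('a, 'b) pre_digraph \<Rightarrow> 'a set \<Rightarrow> bool" where
  "longest_cycle_transversal G T \<longleftrightarrow>
     T \<subseteq> verts G \<and> (\<forall>p. longest_cycle G p \<longrightarrow> T \<inter> cycle_verts G p \<noteq> {})"

text \<open>The minimum exists, since the set of all vertices is a longest cycle transversal.\<close>

definition lct :: "('a, 'b) pre_digraph \<Rightarrow> nat" where
  "lct G = (LEAST k. \<exists>T. longest_cycle_transversal G T \<and> card T = k)"

end

theory Submission
  imports Defs
begin

text \<open>
  In a chordal graph let \<open>B\<close> be a connected vertex set whose neighbourhood is a clique, and suppose
  that every longest cycle not yet covered meets \<open>B\<close>. Some \<open>v\<close> in \<open>B\<close> is adjacent to all neighbours
  of \<open>B\<close>; put \<open>Q = {v} \<union> N(B)\<close>, a clique that separates the components of \<open>B - v\<close> from each other and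
  from the rest. If some uncovered cycle \<open>C\<close> meets \<open>Q\<close> in at most one vertex, then \<open>C - Q\<close> lies in one
  component \<open>L\<close> of \<open>B - v\<close>; since two longest cycles of a 2-connected graph share two vertices, all
  uncovered cycles meet \<open>L\<close>, and \<open>B\<close> is replaced by \<open>L\<close> at no cost.

  Otherwise pass from \<open>B\<close> to the largest component again and again, as long as at least two vertices
  of \<open>Q\<close> are adjacent to it. The cliques met on the way form a spine \<open>M\<close>, all of whose vertices are adjacent to two
  vertices \<open>r, r'\<close> of \<open>Q\<close>, and the components left aside have less than half the size of \<open>B\<close>.
  Let \<open>P\<close> be a longest path through such a component \<open>L\<close> with ends adjacent to distinct vertices \<open>u, w\<close>
  of \<open>M\<close>. A longest cycle that avoids \<open>r\<close> has no edge inside \<open>M\<close>, hence it crosses one of these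
  components, between \<open>d\<close> and \<open>d'\<close> say. If it avoids \<open>r, r', u, w\<close> and \<open>L\<close>, then replacing this
  crossing by \<open>d r u P w r' d'\<close> makes it longer. So four vertices suffice to replace \<open>B\<close> by \<open>L\<close>, and
  \<open>B\<close> can be halved at most \<open>1 + \<lfloor>lg n\<rfloor>\<close> times.
\<close>

section \<open>Walks, cycles and connected sets\<close>

lemma set_butlast_last: "p \<noteq> [] \<Longrightarrow> set p = insert (last p) (set (butlast p))"
  by (cases p rule: rev_cases) auto

lemma disjoint_if_singleton:
  assumes "A \<inter> S = {x}" "T \<subseteq> S" "x \<notin> T" shows "T \<inter> A = {}"
proof (rule equals0I)
  fix y assume "y \<in> T \<inter> A"
  then have "y \<in> A \<inter> S" "y \<in> T" using assms(2) by auto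
  then show False using assms(1,3) by auto
qed

lemma two_le_length: "xs \<noteq> [] \<Longrightarrow> hd xs \<noteq> last xs \<Longrightarrow> 2 \<le> length xs"
  by (cases xs; cases "tl xs") auto

text \<open>Walks and cycles are vertex lists over an edge predicate, so that rotating, cutting and
  splicing become list operations. The digraphs of the theorem are translated in the last
  section.\<close>

locale ugraph =
  fixes V :: "'a set" and E :: "'a \<Rightarrow> 'a \<Rightarrow> bool"
  assumes finite_V: "finite V"
    and E_in_V: "E u v \<Longrightarrow> u \<in> V \<and> v \<in> V"
    and E_sym: "E u v \<Longrightarrow> E v u"
    and E_irrefl: "\<not> E u u"
begin

definition is_walk :: "'a list \<Rightarrow> bool" where
  "is_walk xs \<longleftrightarrow> xs \<noteq> [] \<and> successively E xs"

definition is_cycle :: "'a list \<Rightarrow> bool" where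
  "is_cycle xs \<longleftrightarrow> distinct xs \<and> 3 \<le> length xs \<and> successively E xs \<and> E (last xs) (hd xs)"

definition reach :: "'a set \<Rightarrow> 'a \<Rightarrow> 'a \<Rightarrow> bool" where
  "reach U x y \<longleftrightarrow> (\<exists>xs. is_walk xs \<and> set xs \<subseteq> U \<and> hd xs = x \<and> last xs = y)"

definition conn :: "'a set \<Rightarrow> bool" where
  "conn U \<longleftrightarrow> (\<forall>x\<in>U. \<forall>y\<in>U. reach U x y)"

definition nbh :: "'a set \<Rightarrow> 'a set" where
  "nbh B = {y. y \<notin> B \<and> (\<exists>x\<in>B. E x y)}"

definition clique :: "'a set \<Rightarrow> bool" where
  "clique K \<longleftrightarrow> (\<forall>x\<in>K. \<forall>y\<in>K. x \<noteq> y \<longrightarrow> E x y)"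

definition longest :: "'a list \<Rightarrow> bool" where
  "longest xs \<longleftrightarrow> is_cycle xs \<and> (\<forall>ys. is_cycle ys \<longrightarrow> length ys \<le> length xs)"

lemma nbh_subset_V: "nbh B \<subseteq> V"
  using E_in_V by (auto simp: nbh_def)

lemma is_walk_append:
  assumes "is_walk xs" "is_walk ys" "E (last xs) (hd ys)"
  shows "is_walk (xs @ ys)"
  using assms by (auto simp: is_walk_def successively_append_iff)

lemma is_walk_rev: "is_walk (rev xs) \<longleftrightarrow> is_walk xs"
proof -
  have "successively (\<lambda>x y. E y x) xs \<longleftrightarrow> successively E xs"
    using successively_mono[of E xs "\<lambda>x y. E y x"] successively_mono[of "\<lambda>x y. E y x" xs E] E_sym
    by blast
  then show ?thesis by (auto simp: is_walk_def)
qed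

lemma is_walk_appendD:
  assumes "is_walk (xs @ ys)"
  shows "xs \<noteq> [] \<Longrightarrow> is_walk xs" "ys \<noteq> [] \<Longrightarrow> is_walk ys"
    "xs \<noteq> [] \<Longrightarrow> ys \<noteq> [] \<Longrightarrow> E (last xs) (hd ys)"
  using assms by (auto simp: is_walk_def successively_append_iff)

lemma is_walk_drop: "is_walk xs \<Longrightarrow> i < length xs \<Longrightarrow> is_walk (drop i xs)"
  by (metis append_take_drop_id drop_eq_Nil is_walk_appendD(2) linorder_not_less)

lemma is_walk_take: "is_walk xs \<Longrightarrow> 0 < i \<Longrightarrow> is_walk (take i xs)"
  by (metis append_take_drop_id is_walk_appendD(1) is_walk_def less_numeral_extra(3) take_eq_Nil)

lemma walk_shortcut:
  assumes w: "is_walk xs" and ij: "i < j" "j < length xs" and e: "E (xs ! i) (xs ! j)"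
  shows "is_walk (take (Suc i) xs @ drop j xs)"
proof (rule is_walk_append)
  show "is_walk (take (Suc i) xs)" using w by (rule is_walk_take) simp
  show "is_walk (drop j xs)" using w ij(2) by (rule is_walk_drop)
  show "E (last (take (Suc i) xs)) (hd (drop j xs))"
    using e ij by (simp add: take_Suc_conv_app_nth hd_drop_conv_nth)
qed

text \<open>A shortest walk from X to Y inside U has all these properties at once: a violation would
  allow dropping a prefix, dropping a suffix, or a shortcut along an edge.\<close>

lemma shortest_walk:
  assumes "conn U" "X \<inter> U \<noteq> {}" "Y \<inter> U \<noteq> {}"
  obtains xs where "is_walk xs" "set xs \<subseteq> U" "hd xs \<in> X" "last xs \<in> Y" "distinct xs"
    "\<And>i. 0 < i \<Longrightarrow> i < length xs \<Longrightarrow> xs ! i \<notin> X"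
    "\<And>i. Suc i < length xs \<Longrightarrow> xs ! i \<notin> Y"
    "\<And>i j. Suc i < j \<Longrightarrow> j < length xs \<Longrightarrow> \<not> E (xs ! i) (xs ! j)"
proof -
  define Q where "Q xs \<longleftrightarrow> is_walk xs \<and> set xs \<subseteq> U \<and> hd xs \<in> X \<and> last xs \<in> Y" for xs
  obtain x y where "x \<in> X \<inter> U" "y \<in> Y \<inter> U" using assms by blast
  then obtain xs where "is_walk xs" "set xs \<subseteq> U" "hd xs = x" "last xs = y"
    using assms(1) unfolding conn_def reach_def by blast
  then have "\<exists>xs. Q xs" using \<open>x \<in> X \<inter> U\<close> \<open>y \<in> Y \<inter> U\<close> by (auto simp: Q_def)
  then obtain xs where Q: "Q xs" and min: "\<And>ys. Q ys \<Longrightarrow> length xs \<le> length ys"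
    using ex_has_least_nat[of Q _ length] by blast
  have w: "is_walk xs" "set xs \<subseteq> U" "hd xs \<in> X" "last xs \<in> Y" and ne: "xs \<noteq> []"
    using Q by (auto simp: Q_def is_walk_def)
  have nX: "xs ! i \<notin> X" if "0 < i" "i < length xs" for i
  proof
    assume "xs ! i \<in> X"
    then have "Q (drop i xs)" using that w set_drop_subset[of i xs]
      by (auto simp: Q_def is_walk_drop hd_drop_conv_nth)
    from min[OF this] that show False by simp
  qed
  have nY: "xs ! i \<notin> Y" if "Suc i < length xs" for i
  proof
    assume "xs ! i \<in> Y"
    moreover have "is_walk (take (Suc i) xs)" using w(1) by (rule is_walk_take) simp
    moreover have "hd (take (Suc i) xs) = hd xs" using ne by (cases xs) auto
    moreover have "last (take (Suc i) xs) = xs ! i" using that by (simp add: take_Suc_conv_app_nth)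
    ultimately have "Q (take (Suc i) xs)" using w set_take_subset[of "Suc i" xs]
      by (auto simp: Q_def)
    from min[OF this] that show False by simp
  qed
  have nE: "\<not> E (xs ! i) (xs ! j)" if "Suc i < j" "j < length xs" for i j
  proof
    assume e: "E (xs ! i) (xs ! j)"
    let ?ys = "take (Suc i) xs @ drop j xs"
    have "is_walk ?ys" using walk_shortcut[OF w(1) _ _ e] that by simp
    moreover have "hd ?ys = hd xs" using ne by (cases xs) auto
    moreover have "last ?ys = last xs" using that by simp
    ultimately have "Q ?ys" using w set_take_subset[of "Suc i" xs] set_drop_subset[of j xs]
      by (auto simp: Q_def)
    from min[OF this] that show False by simp
  qed
  \<comment> \<open>For a repetition at positions i < j, either i = 0 and position j lies in X
    again, or the predecessor of position i is adjacent to position j.\<close>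
  have "distinct xs"
  proof (rule ccontr)
    assume "\<not> distinct xs"
    then obtain i j where ij: "i < j" "j < length xs" "xs ! i = xs ! j"
      unfolding distinct_conv_nth by (metis linorder_neqE_nat)
    show False
    proof (cases i)
      case 0
      then have "xs ! j \<in> X" using w(3) ij ne by (simp add: hd_conv_nth)
      then show False using nX[of j] ij by simp
    next
      case (Suc k)
      have "E (xs ! k) (xs ! i)"
        using w(1) ij(1,2) Suc by (simp add: is_walk_def successively_conv_nth)
      then have "E (xs ! k) (xs ! j)" using ij by simp
      then show False using nE[of k j] ij Suc by simp
    qed
  qed
  then show thesis using that w nX nY nE by blast
qed

lemma is_cycle_rotate:
  assumes "is_cycle (as @ bs)" shows "is_cycle (bs @ as)"
  using assms by (cases "as = []"; cases "bs = []") (auto simp: is_cycle_def successively_append_iff)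

text \<open>The list is rotated to a vertex outside L and then to the next vertex in L, so the
  leading run inside L is maximal at both ends. The vertices \<open>hd zs\<close> and
  \<open>last zs\<close> next to it may coincide.\<close>

lemma cycle_segment:
  assumes c: "is_cycle xs" and L: "set xs \<inter> L \<noteq> {}" "\<not> set xs \<subseteq> L"
  obtains ys zs where "is_cycle (ys @ zs)" "set (ys @ zs) = set xs" "length (ys @ zs) = length xs"
    "ys \<noteq> []" "zs \<noteq> []" "set ys \<subseteq> L" "hd zs \<notin> L" "last zs \<notin> L"
proof -
  obtain b where "b \<in> set xs" "b \<notin> L" using L(2) by blast
  then obtain as cs where xs: "xs = as @ b # cs" by (meson split_list)
  let ?r = "b # cs @ as"
  have r: "is_cycle ?r" using is_cycle_rotate[of as "b # cs"] c xs by simp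
  have "\<exists>x\<in>set ?r. x \<in> L" using L(1) xs by auto
  then obtain us w ws where sp: "?r = us @ w # ws" "w \<in> L" "\<forall>x\<in>set us. x \<notin> L"
    using split_list_first_prop[of ?r "\<lambda>x. x \<in> L"] by blast
  have us: "us \<noteq> []" using sp \<open>b \<notin> L\<close> by (cases us) auto
  let ?q = "w # ws @ us"
  have q: "is_cycle ?q" using is_cycle_rotate[of us "w # ws"] r sp by simp
  have lq: "last ?q \<notin> L" using us sp by simp
  have setq: "set ?q = set xs" using sp(1) xs by (metis Un_commute append_Cons set_append)
  have lenq: "length ?q = length xs" using arg_cong[OF sp(1), of length] xs by simp
  define ys zs where "ys = takeWhile (\<lambda>x. x \<in> L) ?q" and "zs = dropWhile (\<lambda>x. x \<in> L) ?q"
  have yz: "ys @ zs = ?q" by (simp add: ys_def zs_def)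
  have "ys \<noteq> []" using sp(2) by (simp add: ys_def)
  have ysL: "set ys \<subseteq> L" using set_takeWhileD by (fastforce simp: ys_def)
  have zs: "zs \<noteq> []"
  proof
    assume "zs = []"
    then have "set ?q \<subseteq> L" using yz ysL by simp
    then show False using us sp(3) by (cases us) auto
  qed
  have "hd zs \<notin> L" using zs hd_dropWhile unfolding zs_def by blast
  moreover have "last zs \<notin> L" using lq yz zs by (metis last_appendR)
  ultimately show thesis using that[of ys zs] yz q setq lenq \<open>ys \<noteq> []\<close> ysL zs by simp
qed

lemma is_cycle_append_iff:
  assumes "ys \<noteq> []" "zs \<noteq> []"
  shows "is_cycle (ys @ zs) \<longleftrightarrow> distinct (ys @ zs) \<and> 3 \<le> length (ys @ zs) \<and>
    is_walk ys \<and> is_walk zs \<and> E (last ys) (hd zs) \<and> E (last zs) (hd ys)"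
  using assms by (auto simp: is_cycle_def is_walk_def successively_append_iff)

lemma cycle_in_V: "is_cycle xs \<Longrightarrow> set xs \<subseteq> V"
proof
  fix x assume c: "is_cycle xs" and "x \<in> set xs"
  then obtain i where i: "i < length xs" "x = xs ! i" by (metis in_set_conv_nth)
  show "x \<in> V"
  proof (cases "Suc i < length xs")
    case True
    then have "E (xs ! i) (xs ! Suc i)" using c by (auto simp: is_cycle_def successively_conv_nth)
    then show ?thesis using i E_in_V by blast
  next
    case False
    then have "x = last xs" using i by (metis Suc_lessI diff_Suc_1 last_conv_nth length_0_conv not_less_zero)
    then show ?thesis using c E_in_V by (auto simp: is_cycle_def)
  qed
qed

text \<open>Otherwise r could subdivide the edge between \<open>last zs\<close> and
  \<open>hd ys\<close>. This is what keeps a longest cycle that avoids r from having an edge whose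
  two ends are adjacent to r.\<close>

lemma longest_no_insert:
  assumes "longest (ys @ zs)" "ys \<noteq> []" "zs \<noteq> []" "r \<notin> set (ys @ zs)"
    "E (last zs) r" "E r (hd ys)"
  shows False
proof -
  have "is_cycle (ys @ (zs @ [r]))"
    using assms by (subst is_cycle_append_iff)
      (auto simp: longest_def is_cycle_append_iff is_walk_def successively_append_iff)
  then show False using assms(1) by (auto simp: longest_def)
qed

section \<open>Components of induced subgraphs\<close>

definition comp :: "'a set \<Rightarrow> 'a \<Rightarrow> 'a set" where
  "comp U x = {y. reach U x y}"

lemma reach_refl: "x \<in> U \<Longrightarrow> reach U x x"
  unfolding reach_def by (rule exI[of _ "[x]"]) (simp add: is_walk_def)

lemma reach_sym:
  assumes "reach U x y" shows "reach U y x"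
proof -
  obtain xs where "is_walk xs" "set xs \<subseteq> U" "hd xs = x" "last xs = y"
    using assms by (auto simp: reach_def)
  then show ?thesis unfolding reach_def
    by (intro exI[of _ "rev xs"]) (auto simp: is_walk_rev hd_rev last_rev)
qed

lemma reach_trans:
  assumes "reach U x y" "reach U y z" shows "reach U x z"
proof -
  obtain xs where xs: "is_walk xs" "set xs \<subseteq> U" "hd xs = x" "last xs = y"
    using assms by (auto simp: reach_def)
  obtain ys where ys: "is_walk ys" "set ys \<subseteq> U" "hd ys = y" "last ys = z"
    using assms by (auto simp: reach_def)
  then obtain zs where zs: "ys = y # zs" by (cases ys) (auto simp: is_walk_def)
  show ?thesis
  proof (cases "zs = []")
    case True
    then show ?thesis using xs ys zs by (auto simp: reach_def)
  next
    case False
    then have "is_walk (xs @ zs)" using xs ys zs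
      by (intro is_walk_append) (auto simp: is_walk_def successively_Cons)
    then show ?thesis using xs ys zs False unfolding reach_def
      by (intro exI[of _ "xs @ zs"]) (auto simp: is_walk_def)
  qed
qed

lemma reach_step: "x \<in> U \<Longrightarrow> y \<in> U \<Longrightarrow> E x y \<Longrightarrow> reach U x y"
  unfolding reach_def by (rule exI[of _ "[x, y]"]) (simp add: is_walk_def)

lemma reach_in:
  assumes "reach U x y" shows "x \<in> U \<and> y \<in> U"
proof -
  obtain xs where xs: "xs \<noteq> []" "set xs \<subseteq> U" "hd xs = x" "last xs = y"
    using assms by (auto simp: reach_def is_walk_def)
  then have "x \<in> set xs" "y \<in> set xs" by auto
  then show ?thesis using xs(2) by blast
qed

text \<open>Each vertex of a walk from x is reached by a prefix of that walk, so the whole walk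
  stays inside the component.\<close>

lemma reach_comp:
  assumes "reach U x y" shows "reach (comp U x) x y"
proof -
  obtain xs where xs: "is_walk xs" "set xs \<subseteq> U" "hd xs = x" "last xs = y"
    using assms by (auto simp: reach_def)
  have "set xs \<subseteq> comp U x"
  proof
    fix z assume "z \<in> set xs"
    then obtain as bs where sp: "xs = as @ z # bs" by (meson split_list)
    then have "xs = (as @ [z]) @ bs" by simp
    then have "is_walk (as @ [z])" using xs(1) is_walk_appendD(1)[of "as @ [z]" bs] by simp
    moreover have "hd (as @ [z]) = x" using sp xs(3) by (cases as) auto
    moreover have "set (as @ [z]) \<subseteq> U" using sp xs(2) by auto
    ultimately show "z \<in> comp U x" unfolding comp_def reach_def by force
  qed
  then show ?thesis using xs by (auto simp: reach_def)
qed

lemma comp_subset: "comp U x \<subseteq> U"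
  using reach_in by (auto simp: comp_def)

lemma comp_self: "x \<in> U \<Longrightarrow> x \<in> comp U x"
  by (simp add: comp_def reach_refl)

lemma comp_conn: "conn (comp U x)"
  unfolding conn_def
proof (intro ballI)
  fix y z assume "y \<in> comp U x" "z \<in> comp U x"
  then have "reach (comp U x) x y" "reach (comp U x) x z"
    using reach_comp by (auto simp: comp_def)
  then show "reach (comp U x) y z" using reach_trans[OF reach_sym] by blast
qed

lemma comp_eq:
  assumes "y \<in> comp U x" shows "comp U y = comp U x"
proof -
  have xy: "reach U x y" using assms by (simp add: comp_def)
  have "reach U y z \<longleftrightarrow> reach U x z" for z
    using reach_trans[OF xy, of z] reach_trans[OF reach_sym[OF xy], of z] by blast
  then show ?thesis by (simp add: comp_def)
qed

lemma nbh_comp: "nbh (comp U x) \<inter> U = {}"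
proof (rule ccontr)
  assume "nbh (comp U x) \<inter> U \<noteq> {}"
  then obtain y z where "y \<in> U" "y \<notin> comp U x" "z \<in> comp U x" "E z y"
    by (auto simp: nbh_def)
  moreover have "z \<in> U" using \<open>z \<in> comp U x\<close> comp_subset by blast
  ultimately have "reach U x z" "reach U z y" using reach_step by (auto simp: comp_def)
  then have "reach U x y" by (rule reach_trans)
  then show False using \<open>y \<notin> comp U x\<close> by (simp add: comp_def)
qed

text \<open>Applied to a vertex v that is adjacent to all of a clique \<open>nbh B\<close>, this
  shows that the components left after removing v again have cliques as neighbourhoods.\<close>

lemma nbh_comp_remove:
  assumes "v \<in> B" shows "nbh (comp (B - {v}) x) \<subseteq> insert v (nbh B)"
proof
  fix y assume y: "y \<in> nbh (comp (B - {v}) x)"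
  then have "y \<notin> B - {v}" using nbh_comp by blast
  moreover obtain z where "z \<in> comp (B - {v}) x" "E z y" using y by (auto simp: nbh_def)
  moreover then have "z \<in> B" using comp_subset by blast
  ultimately show "y \<in> insert v (nbh B)" by (auto simp: nbh_def)
qed

section \<open>Two disjoint paths between vertex sets\<close>

lemma connecting_path:
  assumes "conn U" "X \<inter> U \<noteq> {}" "Y \<inter> U \<noteq> {}"
  obtains xs where "is_walk xs" "distinct xs" "set xs \<subseteq> U" "hd xs \<in> X" "last xs \<in> Y"
    "set (tl xs) \<inter> X = {}" "set (butlast xs) \<inter> Y = {}"
proof (rule shortest_walk[OF assms])
  fix xs
  assume xs: "is_walk xs" "set xs \<subseteq> U" "hd xs \<in> X" "last xs \<in> Y" "distinct xs"
    and nX: "\<And>i. 0 < i \<Longrightarrow> i < length xs \<Longrightarrow> xs ! i \<notin> X"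
    and nY: "\<And>i. Suc i < length xs \<Longrightarrow> xs ! i \<notin> Y"
  have "set (tl xs) \<inter> X = {}"
  proof (intro equals0I)
    fix z assume "z \<in> set (tl xs) \<inter> X"
    then obtain i where "i < length (tl xs)" "z = tl xs ! i" "z \<in> X" by (auto simp: in_set_conv_nth)
    then show False using nX[of "Suc i"] by (simp add: nth_tl)
  qed
  moreover have "set (butlast xs) \<inter> Y = {}"
  proof (intro equals0I)
    fix z assume "z \<in> set (butlast xs) \<inter> Y"
    then obtain i where "i < length (butlast xs)" "z = butlast xs ! i" "z \<in> Y"
      by (auto simp: in_set_conv_nth)
    then show False using nY[of i] by (simp add: nth_butlast)
  qed
  ultimately show thesis using that xs by blast
qed

text \<open>Only the end at B is kept under control, since the induction changes B alone. The other
  end is repaired afterwards by \<open>path_to_trim\<close>, which cuts at the last vertex in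
  A.\<close>

definition path_to :: "'a set \<Rightarrow> 'a set \<Rightarrow> 'a list \<Rightarrow> bool" where
  "path_to A B p \<longleftrightarrow> is_walk p \<and> distinct p \<and> hd p \<in> A \<and> last p \<in> B \<and> set (butlast p) \<inter> B = {}"

text \<open>Induction along a walk from \<open>B\<close> to \<open>A\<close>: its second vertex \<open>b'\<close> is added to \<open>B\<close>, and a path that
  ends in \<open>b'\<close> is then extended to \<open>b\<close>, or redirected if the other path already ends in \<open>b\<close>.\<close>

lemma two_disjoint_paths_aux:
  assumes conn_remove: "\<And>z. conn (V - {z})"
    and A: "A \<subseteq> V" "a1 \<in> A" "a2 \<in> A" "a1 \<noteq> a2"
  shows "is_walk w \<Longrightarrow> hd w \<in> B \<Longrightarrow> last w \<in> A \<Longrightarrow> B \<subseteq> V \<Longrightarrow> b1 \<in> B \<Longrightarrow> b2 \<in> B \<Longrightarrow> b1 \<noteq> b2 \<Longrightarrow>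
    \<exists>p q. path_to A B p \<and> path_to A B q \<and> set p \<inter> set q = {}"
proof (induction w arbitrary: B b1 b2)
  case Nil
  then show ?case by (simp add: is_walk_def)
next
  case (Cons b w)
  have b: "b \<in> B" using Cons.prems(2) by simp
  show ?case
  proof (cases "w = []")
    case True
    then have bA: "b \<in> A" using Cons.prems(3) by simp
    \<comment> \<open>The vertex b lies in both sets and is a path by itself; the second path is
      found in the graph without b.\<close>
    have "A \<inter> (V - {b}) \<noteq> {}" "B \<inter> (V - {b}) \<noteq> {}" using A Cons.prems(4-7) by blast+
    then obtain p where "is_walk p" "distinct p" "set p \<subseteq> V - {b}" "hd p \<in> A" "last p \<in> B"
        "set (butlast p) \<inter> B = {}"
      by (rule connecting_path[OF conn_remove])
    moreover have "path_to A B [b]" using b bA by (simp add: path_to_def is_walk_def)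
    ultimately show ?thesis by (intro exI[of _ p] exI[of _ "[b]"]) (auto simp: path_to_def)
  next
    case False
    define b' where "b' = hd w"
    have bb': "E b b'" and w: "is_walk w"
      using Cons.prems(1) False by (auto simp: is_walk_def successively_Cons b'_def)
    have "\<exists>p q. path_to A (insert b' B) p \<and> path_to A (insert b' B) q \<and> set p \<inter> set q = {}"
      using Cons.IH[OF w, of "insert b' B" b1 b2] Cons.prems False E_in_V[OF bb'] by (auto simp: b'_def)
    then obtain p0 q0 where pq0: "path_to A (insert b' B) p0" "path_to A (insert b' B) q0"
      "set p0 \<inter> set q0 = {}" by blast
    show ?thesis
    proof (cases "b' \<in> B \<or> last p0 \<noteq> b' \<and> last q0 \<noteq> b'")
      case True
      then have "path_to A B p0 \<and> path_to A B q0"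
        using pq0 by (auto simp: path_to_def insert_absorb)
      then show ?thesis using pq0(3) by blast
    next
      case False
      then have b'B: "b' \<notin> B" by simp
      \<comment> \<open>The paths are disjoint, so exactly one of them ends in b'; it is named
        q.\<close>
      obtain p q where p: "path_to A (insert b' B) p" and q: "path_to A (insert b' B) q"
        and pq: "set p \<inter> set q = {}" and lq: "last q = b'"
        using False pq0 by (cases "last q0 = b'") blast+
      have pne: "p \<noteq> []" and qne: "q \<noteq> []" using p q by (auto simp: path_to_def is_walk_def)
      have lp: "last p \<in> B"
      proof -
        have "last p \<noteq> b'" using lq pq last_in_set[OF pne] last_in_set[OF qne] by force
        then show ?thesis using p by (auto simp: path_to_def)
      qed
      have pB: "set (butlast p) \<inter> B = {}" and qB: "set q \<inter> B = {}"
        using p q b'B set_butlast_last[OF qne] lq by (auto simp: path_to_def)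
      have bq: "b \<notin> set q" using qB b by blast
      have qb: "is_walk (q @ [b])"
        using is_walk_append[of q "[b]"] q lq bb' E_sym by (auto simp: path_to_def is_walk_def)
      have qb: "path_to A B (q @ [b])"
        using q qb b bq qB qne by (auto simp: path_to_def)
      show ?thesis
      proof (cases "last p = b")
        case lpb: False
        have "path_to A B p" using p lp by (auto simp: path_to_def)
        moreover have "b \<notin> set p" using set_butlast_last[OF pne] lpb pB b by auto
        ultimately show ?thesis using qb pq by (intro exI[of _ p] exI[of _ "q @ [b]"]) auto
      next
        case lpb: True
        \<comment> \<open>Both paths now claim b. A path T that avoids b leads from X to B and
          leaves X at its first vertex h. The path through h is redirected along T, and b is left to
          the other one.\<close>
        define X where "X = (set p \<union> set q) - {b}"
        have hq: "hd q \<in> set q" "hd q \<in> A" using q qne by (auto simp: path_to_def)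
        have "hd q \<in> X \<inter> (V - {b})" using hq A(1) bq by (auto simp: X_def)
        then have "X \<inter> (V - {b}) \<noteq> {}" by blast
        moreover have "B \<inter> (V - {b}) \<noteq> {}" using Cons.prems(4-7) by blast
        ultimately obtain T where T: "is_walk T" "distinct T" "set T \<subseteq> V - {b}" "hd T \<in> X" "last T \<in> B"
            "set (tl T) \<inter> X = {}" "set (butlast T) \<inter> B = {}"
          by (rule connecting_path[OF conn_remove])
        have Tne: "T \<noteq> []" using T(1) by (simp add: is_walk_def)
        define h where "h = hd T"
        have Th: "T = h # tl T" using Tne by (simp add: h_def)
        have setT: "set T = insert h (set (tl T))" using Th by (metis list.simps(15))
        have redirect: "path_to A B (r1 @ T)"
          if r: "is_walk (r1 @ h # r2)" "distinct (r1 @ h # r2)" "hd (r1 @ h # r2) \<in> A"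
            and r1: "set r1 \<inter> B = {}" "set r1 \<subseteq> X" for r1 r2
        proof -
          have "is_walk (r1 @ T)"
            using r(1) T(1) Th by (cases "r1 = []") (auto simp: is_walk_def successively_append_iff h_def)
          moreover have "distinct (r1 @ T)" using r(2) T(2,6) r1(2) setT by auto
          moreover have "hd (r1 @ T) \<in> A" using r(3) by (cases r1) (auto simp: h_def)
          moreover have "set (butlast (r1 @ T)) \<inter> B = {}"
            using r1(1) T(7) Tne by (auto simp: butlast_append)
          ultimately show ?thesis using T(5) Tne by (simp add: path_to_def)
        qed
        show ?thesis
        proof (cases "h \<in> set p")
          case True
          then obtain r1 r2 where r: "p = r1 @ h # r2" by (meson split_list)
          have "h \<noteq> b" using T(4) by (auto simp: X_def h_def)
          then have "r2 \<noteq> []" using lpb r by auto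
          then have r1: "set r1 \<inter> B = {}" using pB r by (auto simp: butlast_append)
          then have r1X: "set r1 \<subseteq> X" using r b by (auto simp: X_def)
          have "path_to A B (r1 @ T)"
            using redirect[of r1 r2] r r1 r1X p by (auto simp: path_to_def)
          moreover have "h \<notin> set q" using True pq by blast
          then have "set (r1 @ T) \<inter> set (q @ [b]) = {}"
            using r pq r1X T(3,6) setT bq by (auto simp: X_def)
          ultimately show ?thesis using qb by blast
        next
          case False
          then have hq: "h \<in> set q" using T(4) by (auto simp: X_def h_def)
          then obtain r1 r2 where r: "q = r1 @ h # r2" by (meson split_list)
          have "path_to A B (r1 @ T)"
            using redirect[of r1 r2] r qB bq q by (auto simp: path_to_def X_def)
          moreover have "set p \<inter> set (r1 @ T) = {}"
            using r pq T(3,6) setT False by (auto simp: X_def)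
          moreover have "path_to A B p" using p lp by (auto simp: path_to_def)
          ultimately show ?thesis by blast
        qed
      qed
    qed
  qed
qed

lemma path_to_trim:
  assumes "path_to A B p"
  obtains q where "is_walk q" "distinct q" "hd q \<in> A" "last q \<in> B" "set q \<subseteq> set p"
    "set q \<inter> A = {hd q}" "set q \<inter> B = {last q}"
proof -
  have p: "is_walk p" "p \<noteq> []" "distinct p" "hd p \<in> A" "last p \<in> B" "set (butlast p) \<inter> B = {}"
    using assms by (auto simp: path_to_def is_walk_def)
  then have "\<exists>x\<in>set p. x \<in> A" using hd_in_set by blast
  then obtain p1 a p2 where sp: "p = p1 @ a # p2" "a \<in> A" "\<forall>x\<in>set p2. x \<notin> A"
    using split_list_last_prop[of p "\<lambda>x. x \<in> A"] by blast
  have "is_walk (a # p2)" using is_walk_appendD(2)[of p1 "a # p2"] p sp by simp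
  moreover have "set (a # p2) \<inter> B = {last (a # p2)}"
  proof -
    have "set (butlast (a # p2)) \<inter> B = {}" using p(6) sp(1) by (auto simp: butlast_append)
    moreover have "last (a # p2) \<in> B" using p(5) sp(1) by simp
    ultimately show ?thesis using set_butlast_last[of "a # p2"] by blast
  qed
  moreover have "set (a # p2) \<inter> A = {hd (a # p2)}" using sp(2,3) by auto
  moreover have "last (a # p2) \<in> B" using p(5) sp(1) by simp
  moreover have "distinct (a # p2)" "set (a # p2) \<subseteq> set p" using p(3) sp(1) by auto
  ultimately show thesis using that[of "a # p2"] sp(2) by (simp only: list.sel)
qed

text \<open>Menger's theorem for two paths, with 2-connectivity expressed by
  \<open>conn_remove\<close>. Trimming at both sets makes the paths meet A and B in their ends
  only.\<close>

lemma two_disjoint_paths: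
  assumes conn_remove: "\<And>z. conn (V - {z})" and "conn V"
    and A: "A \<subseteq> V" "a1 \<in> A" "a2 \<in> A" "a1 \<noteq> a2"
    and B: "B \<subseteq> V" "b1 \<in> B" "b2 \<in> B" "b1 \<noteq> b2"
  obtains p q where "is_walk p" "distinct p" "set p \<inter> A = {hd p}" "set p \<inter> B = {last p}"
    "is_walk q" "distinct q" "set q \<inter> A = {hd q}" "set q \<inter> B = {last q}" "set p \<inter> set q = {}"
proof -
  obtain w where "is_walk w" "hd w = b1" "last w = a1"
    using \<open>conn V\<close> A(1,2) B(1,2) unfolding conn_def reach_def by (meson subsetD)
  then obtain p q where p: "path_to A B p" and q: "path_to A B q" and pq: "set p \<inter> set q = {}"
    using two_disjoint_paths_aux[OF conn_remove A, of w B b1 b2] B A(2) by auto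
  obtain p' where p': "is_walk p'" "distinct p'" "set p' \<subseteq> set p" "set p' \<inter> A = {hd p'}" "set p' \<inter> B = {last p'}"
    by (rule path_to_trim[OF p])
  obtain q' where q': "is_walk q'" "distinct q'" "set q' \<subseteq> set q" "set q' \<inter> A = {hd q'}" "set q' \<inter> B = {last q'}"
    by (rule path_to_trim[OF q])
  moreover have "set p' \<inter> set q' = {}" using p'(3) q'(3) pq by blast
  ultimately show thesis using that[of p' q'] p' by blast
qed

section \<open>Intersection of longest cycles\<close>

lemma cycle_long_arc:
  assumes c: "is_cycle xs" and x: "x \<in> set xs" "y \<in> set xs" "x \<noteq> y"
  obtains as where "is_walk (x # as @ [y])" "distinct (x # as @ [y])" "set as \<subseteq> set xs"
    "length xs \<le> 2 * length as + 2"
proof -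
  obtain us ws where xs: "xs = us @ x # ws" using x(1) by (meson split_list)
  let ?r = "x # ws @ us"
  have r: "is_cycle ?r" using is_cycle_rotate[of us "x # ws"] c xs by simp
  have "y \<in> set (ws @ us)" using x xs by auto
  then obtain c1 c2 where sp: "ws @ us = c1 @ y # c2" by (meson split_list)
  have r': "is_cycle (x # c1 @ y # c2)" using r sp by simp
  have setr: "set xs = set (x # c1 @ y # c2)" using sp xs by (metis Un_commute append_Cons set_append)
  \<comment> \<open>The inner vertices c1 and c2 of the two arcs make up the cycle without x and y,
    so the larger of the two has at least half of them.\<close>
  have len: "length xs = length c1 + length c2 + 2"
    using arg_cong[OF sp, of length] xs by simp
  have w1: "is_walk (x # c1 @ [y])"
    using r' by (auto simp: is_cycle_def is_walk_def successively_append_iff successively_Cons hd_append)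
  have "is_walk ((y # c2) @ [x])"
    using r' by (intro is_walk_append) (auto simp: is_cycle_def is_walk_def successively_append_iff successively_Cons)
  then have w2: "is_walk (x # rev c2 @ [y])" using is_walk_rev[of "y # c2 @ [x]"] by simp
  have d: "distinct (x # c1 @ y # c2)" using r' by (simp add: is_cycle_def)
  show thesis
  proof (cases "length c1 \<le> length c2")
    case True
    then show ?thesis using that[of "rev c2"] w2 d setr len by auto
  next
    case False
    then show ?thesis using that[of c1] w1 d setr len by auto
  qed
qed

text \<open>Disjoint longest cycles could be joined by two disjoint paths, and cycles that share
  only v by one path avoiding v. Following the longer arc on each cycle then gives a cycle that is
  too long.\<close>

lemma longest_cycles_share_two:
  assumes conn_remove: "\<And>z. conn (V - {z})" and "conn V"
    and xs: "longest xs" and ys: "longest ys"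
  obtains u w where "u \<in> set xs \<inter> set ys" "w \<in> set xs \<inter> set ys" "u \<noteq> w"
proof -
  let ?A = "set xs" and ?B = "set ys"
  have cx: "is_cycle xs" and cy: "is_cycle ys" and len: "length xs = length ys"
    using xs ys by (auto simp: longest_def le_antisym)
  have sub: "?A \<subseteq> V" "?B \<subseteq> V" using cx cy cycle_in_V by auto
  have two: "\<exists>u\<in>set zs. u \<noteq> v" if z: "is_cycle zs" for zs v
  proof -
    obtain a b cs where "zs = a # b # cs"
      using z by (auto simp: is_cycle_def numeral_3_eq_3 Suc_le_length_iff)
    then show ?thesis using z by (auto simp: is_cycle_def)
  qed
  have no: "\<not> is_cycle zs" if "length xs < length zs" for zs
    using xs that by (auto simp: longest_def not_le)
  have "\<exists>u w. u \<in> ?A \<inter> ?B \<and> w \<in> ?A \<inter> ?B \<and> u \<noteq> w"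
  proof (rule ccontr)
    assume n: "\<not> ?thesis"
    show False
    proof (cases "?A \<inter> ?B = {}")
      case True
      obtain a b where a: "a \<in> ?A" and b: "b \<in> ?B" using two[OF cx] two[OF cy] by blast
      obtain a' where a': "a' \<in> ?A" "a' \<noteq> a" using two[OF cx] by blast
      obtain b' where b': "b' \<in> ?B" "b' \<noteq> b" using two[OF cy] by blast
      obtain p q where p: "is_walk p" "distinct p" "set p \<inter> ?A = {hd p}" "set p \<inter> ?B = {last p}"
        and q: "is_walk q" "distinct q" "set q \<inter> ?A = {hd q}" "set q \<inter> ?B = {last q}"
        and pq: "set p \<inter> set q = {}"
        by (rule two_disjoint_paths[OF conn_remove \<open>conn V\<close> sub(1) a'(1) a a'(2) sub(2) b'(1) b b'(2)])
      have ne: "p \<noteq> []" "q \<noteq> []" using p(1) q(1) by (auto simp: is_walk_def)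
      have ends: "hd p \<in> ?A" "hd q \<in> ?A" "last p \<in> ?B" "last q \<in> ?B"
        using p(3,4) q(3,4) by blast+
      have "hd p \<in> set p" "last p \<in> set p" "hd q \<in> set q" "last q \<in> set q" using ne by simp_all
      then have ends_ne: "hd p \<noteq> hd q" "last q \<noteq> last p" using pq by force+
      obtain as where as: "is_walk (hd p # as @ [hd q])" "distinct (hd p # as @ [hd q])" "set as \<subseteq> ?A"
        "length xs \<le> 2 * length as + 2"
        by (rule cycle_long_arc[OF cx ends(1,2) ends_ne(1)])
      obtain bs where bs: "is_walk (last q # bs @ [last p])" "distinct (last q # bs @ [last p])" "set bs \<subseteq> ?B"
        "length ys \<le> 2 * length bs + 2"
        by (rule cycle_long_arc[OF cy ends(4,3) ends_ne(2)])
      have pl: "2 \<le> length p" "2 \<le> length q"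
      proof -
        have "hd p \<noteq> last p" "hd q \<noteq> last q" using ends True by force+
        then show "2 \<le> length p" "2 \<le> length q" using ne two_le_length by blast+
      qed
      \<comment> \<open>Together the arcs have at least \<open>length xs - 2\<close> inner vertices
        and the two paths at least four vertices, a surplus of two.\<close>
      let ?c = "(as @ q) @ (bs @ rev p)"
      have "is_walk (as @ q)" using as(1) q(1)
        by (auto simp: is_walk_def successively_append_iff successively_Cons)
      moreover have "is_walk (rev p)" using p(1) by (simp add: is_walk_rev)
      then have "is_walk (bs @ rev p)" using bs(1) ne
        by (auto simp: is_walk_def successively_append_iff successively_Cons hd_rev)
      moreover have "E (last (as @ q)) (hd (bs @ rev p))" using bs(1) ne
        by (cases bs) (auto simp: is_walk_def hd_rev)
      moreover have "E (last (bs @ rev p)) (hd (as @ q))" using as(1) ne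
        by (cases as) (auto simp: is_walk_def last_rev)
      moreover have "distinct ?c"
      proof -
        have na: "hd p \<notin> set as" "hd q \<notin> set as" and nb: "last p \<notin> set bs" "last q \<notin> set bs"
          using as(2) bs(2) by auto
        have "set as \<inter> set q = {}" by (rule disjoint_if_singleton[OF q(3) as(3) na(2)])
        moreover have "set bs \<inter> set p = {}" by (rule disjoint_if_singleton[OF p(4) bs(3) nb(1)])
        moreover have "set as \<inter> set p = {}" by (rule disjoint_if_singleton[OF p(3) as(3) na(1)])
        moreover have "set bs \<inter> set q = {}" by (rule disjoint_if_singleton[OF q(4) bs(3) nb(2)])
        moreover have "set as \<inter> set bs = {}" using as(3) bs(3) True by blast
        ultimately show ?thesis using as(2) bs(2) p(2) q(2) pq by (simp add: Int_Un_distrib Int_Un_distrib2 Int_commute)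
      qed
      ultimately have "is_cycle ?c"
        using ne pl by (subst is_cycle_append_iff) auto
      then show False using no[of ?c] as(4) bs(4) pl len by simp
    next
      case False
      then obtain v where v: "?A \<inter> ?B = {v}" using n by blast
      have "?A \<inter> (V - {v}) \<noteq> {}" "?B \<inter> (V - {v}) \<noteq> {}"
        using two[OF cx, of v] two[OF cy, of v] sub by blast+
      then obtain p where p: "is_walk p" "distinct p" "set p \<subseteq> V - {v}" "hd p \<in> ?A" "last p \<in> ?B"
          "set (tl p) \<inter> ?A = {}" "set (butlast p) \<inter> ?B = {}"
        by (rule connecting_path[OF conn_remove])
      have ne: "p \<noteq> []" using p(1) by (auto simp: is_walk_def)
      have vp: "v \<notin> set p" "hd p \<in> set p" "last p \<in> set p" using p(3) ne by auto
      have pA: "set p \<inter> ?A = {hd p}" using p(4,6) ne by (cases p) auto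
      have pB: "set p \<inter> ?B = {last p}" using p(5,7) set_butlast_last[OF ne] by auto
      have pv: "v \<noteq> hd p" "last p \<noteq> v" and vv: "v \<in> ?A" "v \<in> ?B" using vp v by auto
      obtain as where as: "is_walk (v # as @ [hd p])" "distinct (v # as @ [hd p])" "set as \<subseteq> ?A"
        "length xs \<le> 2 * length as + 2"
        by (rule cycle_long_arc[OF cx vv(1) p(4) pv(1)])
      obtain bs where bs: "is_walk (last p # bs @ [v])" "distinct (last p # bs @ [v])" "set bs \<subseteq> ?B"
        "length ys \<le> 2 * length bs + 2"
        by (rule cycle_long_arc[OF cy p(5) vv(2) pv(2)])
      have pl: "2 \<le> length p"
      proof -
        have "hd p \<noteq> last p" using p(4,5) v vp by force
        then show ?thesis using ne two_le_length by blast
      qed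
      \<comment> \<open>The arcs again give \<open>length xs - 2\<close>; the vertex v and the at
        least two vertices of p bring a surplus of one.\<close>
      let ?c = "(v # as) @ (p @ bs)"
      have "is_walk (v # as)" using as(1)
        by (auto simp: is_walk_def successively_append_iff successively_Cons hd_append split: if_splits)
      moreover have "is_walk (p @ bs)" using bs(1) p(1)
        by (auto simp: is_walk_def successively_append_iff successively_Cons hd_append split: if_splits)
      moreover have "E (last (v # as)) (hd (p @ bs))" using as(1) ne
        by (auto simp: is_walk_def successively_append_iff successively_Cons)
      moreover have "E (last (p @ bs)) (hd (v # as))" using bs(1) ne
        by (cases "bs = []") (auto simp: is_walk_def successively_append_iff successively_Cons)
      moreover have "distinct ?c"
      proof -
        have na: "hd p \<notin> set as" "v \<notin> set as" "distinct as"
          and nb: "last p \<notin> set bs" "v \<notin> set bs" "distinct bs"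
          using as(2) bs(2) by auto
        have "set as \<inter> set p = {}" by (rule disjoint_if_singleton[OF pA as(3) na(1)])
        moreover have "set bs \<inter> set p = {}" by (rule disjoint_if_singleton[OF pB bs(3) nb(1)])
        moreover have "set as \<inter> set bs = {}"
          using disjoint_if_singleton[OF _ as(3) na(2), of "set ys"] v bs(3) by (auto simp: Int_commute)
        moreover note na nb
        ultimately show ?thesis using p(2) vp(1) by (simp add: Int_Un_distrib Int_Un_distrib2 Int_commute)
      qed
      ultimately have "is_cycle ?c"
        using ne pl by (subst is_cycle_append_iff) auto
      then show False using no[of ?c] as(4) bs(4) pl len by simp
    qed
  qed
  then show thesis using that by blast
qed

end

section \<open>Clique separators of chordal graphs\<close>

text \<open>A chord is given by two positions, so that consecutive vertices, and the first and last
  vertex with their closing edge, are excluded by arithmetic alone.\<close>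

locale chordal_ugraph = ugraph +
  assumes chord: "is_cycle xs \<Longrightarrow> 4 \<le> length xs \<Longrightarrow>
    \<exists>i j. Suc i < j \<and> j < length xs \<and> \<not> (i = 0 \<and> Suc j = length xs) \<and> E (xs ! i) (xs ! j)"
begin

text \<open>Take \<open>v\<close> in \<open>B\<close> with the most neighbours in the clique. If it misses \<open>y\<close>, a shortest path in \<open>B\<close> from \<open>v\<close>
  to a neighbour of \<open>y\<close>, together with \<open>y\<close> and a neighbour of \<open>v\<close> in the clique, yields a chordless cycle.\<close>

lemma clique_nbh_dominated:
  assumes B: "conn B" "B \<noteq> {}" "B \<subseteq> V" and K: "clique (nbh B)"
  obtains v where "v \<in> B" "\<forall>y\<in>nbh B. E v y"
proof -
  let ?K = "nbh B"
  have finB: "finite B" using B(3) finite_V finite_subset by blast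
  have finK: "finite ?K" using nbh_subset_V finite_V finite_subset by blast
  define f where "f v = card {y \<in> ?K. E v y}" for v
  have "Max (f ` B) \<in> f ` B" using finB B(2) by (intro Max_in) auto
  then obtain v where v: "v \<in> B" and fv: "f v = Max (f ` B)" by auto
  have max: "f a \<le> f v" if "a \<in> B" for a
    unfolding fv using finB that by (intro Max_ge) auto
  show thesis
  proof (rule ccontr)
    assume "\<not> thesis"
    then have "\<exists>y. y \<in> ?K \<and> \<not> E v y" using that[OF v] by blast
    then obtain y where y: "y \<in> ?K" "\<not> E v y" by blast
    define Y where "Y = {b \<in> B. E b y}"
    have "{v} \<inter> B \<noteq> {}" "Y \<inter> B \<noteq> {}" using y(1) v by (auto simp: Y_def nbh_def)
    then obtain ps where ps: "is_walk ps" "set ps \<subseteq> B" "hd ps = v" "last ps \<in> Y" "distinct ps"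
      and nY: "\<And>i. Suc i < length ps \<Longrightarrow> ps ! i \<notin> Y"
      and nE: "\<And>i j. Suc i < j \<Longrightarrow> j < length ps \<Longrightarrow> \<not> E (ps ! i) (ps ! j)"
      by (rule shortest_walk[OF B(1)]) (rule that, auto)
    have ne: "ps \<noteq> []" using ps(1) by (simp add: is_walk_def)
    define a where "a = last ps"
    have a: "a \<in> B" "E a y" using ps(4) by (auto simp: a_def Y_def)
    \<comment> \<open>The vertex a sees y and v does not. As v has the most neighbours in the
      clique, it must see some x that a misses.\<close>
    have "\<exists>x\<in>?K. E v x \<and> \<not> E a x"
    proof (rule ccontr)
      assume "\<not> ?thesis"
      then have "{x \<in> ?K. E v x} \<subset> {x \<in> ?K. E a x}" using y a by blast
      then have "f v < f a" unfolding f_def using finK by (intro psubset_card_mono) auto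
      then show False using max[OF a(1)] by simp
    qed
    then obtain x where x: "x \<in> ?K" "E v x" "\<not> E a x" by blast
    \<comment> \<open>Cutting the path at the last neighbour of x leaves x with no further neighbour
      on it. Since a is not adjacent to x, at least two path vertices remain, enough for a cycle on
      four vertices.\<close>
    define i where "i = (GREATEST i. i < length ps \<and> E (ps ! i) x)"
    have "0 < length ps \<and> E (ps ! 0) x" using ne x ps(3) by (simp add: hd_conv_nth)
    then have i: "i < length ps" "E (ps ! i) x"
      unfolding i_def using GreatestI_nat[of "\<lambda>i. i < length ps \<and> E (ps ! i) x" 0 "length ps"] by auto
    have imax: "\<not> E (ps ! j) x" if "i < j" "j < length ps" for j
      using Greatest_le_nat[of "\<lambda>i. i < length ps \<and> E (ps ! i) x" j "length ps"] that
      unfolding i_def by fastforce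
    have il: "Suc i < length ps"
      using i x(3) ne unfolding a_def by (metis Suc_lessI diff_Suc_1 last_conv_nth)
    let ?qs = "drop i ps"
    let ?c = "x # ?qs @ [y]"
    have q0: "?qs \<noteq> []" and ql: "last ?qs = a" and qh: "hd ?qs = ps ! i"
      using i by (auto simp: a_def hd_drop_conv_nth)
    have notB: "x \<notin> B" "y \<notin> B" using x(1) y(1) by (auto simp: nbh_def)
    have qB: "set ?qs \<subseteq> B" using ps(2) set_drop_subset[of i ps] by blast
    have xy: "x \<noteq> y" using x(2) y(2) by blast
    have "E y x" using K x(1) y(1) xy by (auto simp: clique_def)
    moreover have "is_walk ?qs" using is_walk_drop[OF ps(1) i(1)] .
    moreover have "distinct ?c" using ps(5) qB notB xy by auto
    ultimately have "is_cycle ?c"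
      using q0 ql qh i a E_sym il
      by (auto simp: is_cycle_def is_walk_def successively_append_iff successively_Cons)
    moreover have "4 \<le> length ?c" using il by simp
    ultimately obtain p q where pq: "Suc p < q" "q < length ?c" "\<not> (p = 0 \<and> Suc q = length ?c)"
      "E (?c ! p) (?c ! q)" using chord by blast
    obtain q' where q': "q = Suc q'" using pq(1) by (cases q) auto
    \<comment> \<open>A chord at x contradicts the choice of i, a chord at y contradicts
      \<open>nY\<close>, and a chord between path vertices contradicts \<open>nE\<close>.\<close>
    show False
    proof (cases "p = 0")
      case True
      then have "q' < length ?qs" using pq q' by simp
      then have "E x (ps ! (i + q'))" using pq(4) q' True by (simp add: nth_append)
      moreover have "i < i + q'" "i + q' < length ps" using \<open>q' < length ?qs\<close> pq(1) q' True by auto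
      ultimately show False using imax[of "i + q'"] E_sym by blast
    next
      case False
      then obtain p' where p': "p = Suc p'" by (cases p) auto
      then have p'l: "Suc p' < length ?qs \<or> Suc p' = length ?qs" using pq q' by auto
      have cp: "?c ! p = ps ! (i + p')" using p' pq q' by (auto simp: nth_append)
      show False
      proof (cases "q' < length ?qs")
        case True
        then have "?c ! q = ps ! (i + q')" using q' by (simp add: nth_append)
        then show False using nE[of "i + p'" "i + q'"] pq(1,4) cp True q' p' by auto
      next
        case False
        then have "q' = length ?qs" using pq(2) q' by simp
        then have "?c ! q = y" using q' by (simp add: nth_append)
        moreover have "Suc (i + p') < length ps" using \<open>q' = length ?qs\<close> pq(1) q' p' by simp
        moreover then have "ps ! (i + p') \<in> B" using ps(2) by (meson Suc_lessD nth_mem subsetD)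
        ultimately show False using nY[of "i + p'"] pq(4) cp by (auto simp: Y_def)
      qed
    qed
  qed
qed

text \<open>\<open>Q0\<close> is the clique at the start of the descent and stays fixed in the induction. In the last clause, a
  vertex \<open>e\<close> lying beyond the end of the spine sees at most the vertex \<open>r\<close> of \<open>Q0\<close>.\<close>

lemma spine_decomposition:
  assumes "conn B" "v \<in> B" "B \<subseteq> V" "\<forall>y\<in>nbh B. E v y" "clique (nbh B)"
    and "Q0 \<inter> B \<subseteq> {v}" "x1 \<in> Q0 \<inter> insert v (nbh B)" "x2 \<in> Q0 \<inter> insert v (nbh B)" "x1 \<noteq> x2"
  shows "\<exists>r r' M \<L>. r \<noteq> r' \<and> r \<in> Q0 \<inter> insert v (nbh B) \<and> r' \<in> Q0 \<inter> insert v (nbh B) \<and>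
    insert v (nbh B) \<subseteq> M \<and> M \<subseteq> B \<union> nbh B \<and>
    (\<forall>x\<in>M. (x = r \<or> E x r) \<and> (x = r' \<or> E x r')) \<and>
    (\<forall>L\<in>\<L>. L \<noteq> {} \<and> conn L \<and> L \<subseteq> B - M \<and> clique (nbh L) \<and> nbh L \<subseteq> M \<and> 2 * card L < card B) \<and>
    (\<forall>e\<in>B - M. (\<exists>L\<in>\<L>. e \<in> L) \<or> (\<forall>d\<in>Q0. E e d \<longrightarrow> d = r))"
  using assms
proof (induction "card B" arbitrary: B v x1 x2 rule: less_induct)
  case less
  note B = less.prems(1-5) and Q0B = less.prems(6) and x12 = less.prems(7-9)
  define Q where "Q = insert v (nbh B)"
  define U where "U = B - {v}"
  have finB: "finite B" using B(3) finite_V finite_subset by blast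
  have cQ: "clique Q" using B(4,5) E_sym by (auto simp: clique_def Q_def)
  have Qadj: "x = r \<or> E x r" if "x \<in> Q" "r \<in> Q" for x r
    using cQ that by (auto simp: clique_def)
  have QB: "Q \<inter> U = {}" by (auto simp: Q_def U_def nbh_def)
  define \<C> where "\<C> = comp U ` U"
  have comps: "L \<noteq> {}" "conn L" "L \<subseteq> U" "nbh L \<subseteq> Q" "clique (nbh L)" "L \<inter> Q = {}" if L: "L \<in> \<C>" for L
  proof -
    obtain x where x: "x \<in> U" "L = comp U x" using L by (auto simp: \<C>_def)
    show "L \<noteq> {}" using x comp_self by blast
    show "conn L" using x comp_conn by simp
    show "L \<subseteq> U" using x comp_subset by simp
    then show "L \<inter> Q = {}" using QB by blast
    show nQ: "nbh L \<subseteq> Q" using nbh_comp_remove[OF B(2)] x by (simp add: Q_def U_def)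
    then show "clique (nbh L)" using cQ by (auto simp: clique_def)
  qed
  have disj: "L \<inter> L' = {}" if L: "L \<in> \<C>" "L' \<in> \<C>" "L \<noteq> L'" for L L'
  proof (rule equals0I)
    fix y assume y: "y \<in> L \<inter> L'"
    obtain x x' where "L = comp U x" "L' = comp U x'" using L by (auto simp: \<C>_def)
    then have "comp U y = L" "comp U y = L'" using y comp_eq by auto
    then show False using L(3) by simp
  qed
  have cover: "\<exists>L\<in>\<C>. e \<in> L" if "e \<in> U" for e
    using that comp_self by (auto simp: \<C>_def)
  show ?case
  proof (cases "U = {}")
    case True
    then have "B - Q = {}" using B(2) by (auto simp: U_def Q_def)
    then show ?thesis
      using x12 Qadj True B(2) unfolding Q_def[symmetric]
      by (intro exI[of _ x1] exI[of _ x2] exI[of _ Q] exI[of _ "{}"]) (auto simp: Q_def)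
  next
    case False
    have "finite \<C>" "\<C> \<noteq> {}" using finB False by (auto simp: \<C>_def U_def)
    then have "Max (card ` \<C>) \<in> card ` \<C>" by (intro Max_in) auto
    then obtain H where H: "H \<in> \<C>" and cH: "card H = Max (card ` \<C>)" by auto
    have Hmax: "card L \<le> card H" if "L \<in> \<C>" for L
      unfolding cH using \<open>finite \<C>\<close> that by (intro Max_ge) auto
    have cardU: "card U < card B" unfolding U_def using finB B(2) by (rule card_Diff1_less)
    have finU: "finite U" using finB by (simp add: U_def)
    have cardH: "card H < card B"
      using card_mono[OF finU comps(3)[OF H]] cardU by simp
    \<comment> \<open>Such an L is disjoint from H and not larger, and both fit into B without
      v.\<close>
    have light: "2 * card L < card B" if "L \<in> \<C> - {H}" for L
    proof -
      have LH: "L \<inter> H = {}" using disj[of L H] that H by simp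
      have sub: "L \<union> H \<subseteq> U" using comps(3)[OF H] comps(3)[of L] that by simp
      then have "finite L" "finite H" using finU finite_subset by blast+
      then have "card L + card H \<le> card U"
        using card_Un_disjoint[OF _ _ LH] card_mono[OF finU sub] by simp
      then show ?thesis using Hmax[of L] that cardU by simp
    qed
    have Q0H: "Q0 \<inter> H = {}" using Q0B comps(3)[OF H] by (auto simp: U_def)
    have HQ: "nbh H \<subseteq> Q" "H \<inter> Q = {}" "H \<subseteq> B" using comps[OF H] by (auto simp: U_def)
    \<comment> \<open>The descent continues into the largest component H as long as H has two
      neighbours in \<open>Q0\<close>.\<close>
    show ?thesis
    proof (cases "\<exists>y1 y2. y1 \<in> Q0 \<inter> nbh H \<and> y2 \<in> Q0 \<inter> nbh H \<and> y1 \<noteq> y2")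
      case True
      then obtain y1 y2 where y: "y1 \<in> Q0 \<inter> nbh H" "y2 \<in> Q0 \<inter> nbh H" "y1 \<noteq> y2" by blast
      have HV: "H \<subseteq> V" using HQ(3) B(3) by blast
      obtain h where h: "h \<in> H" "\<forall>y\<in>nbh H. E h y"
        by (rule clique_nbh_dominated[OF comps(2)[OF H] comps(1)[OF H] HV comps(5)[OF H]])
      have "Q0 \<inter> H \<subseteq> {h}" "y1 \<in> Q0 \<inter> insert h (nbh H)" "y2 \<in> Q0 \<inter> insert h (nbh H)"
        using Q0H y by auto
      from less.hyps[OF cardH comps(2)[OF H] h(1) HV h(2) comps(5)[OF H] this y(3)]
      obtain r r' M \<L> where IH: "r \<noteq> r'" "r \<in> Q0 \<inter> insert h (nbh H)" "r' \<in> Q0 \<inter> insert h (nbh H)"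
        "insert h (nbh H) \<subseteq> M" "M \<subseteq> H \<union> nbh H"
        and Madj: "\<forall>x\<in>M. (x = r \<or> E x r) \<and> (x = r' \<or> E x r')"
        and pieces: "\<forall>L\<in>\<L>. L \<noteq> {} \<and> conn L \<and> L \<subseteq> H - M \<and> clique (nbh L) \<and> nbh L \<subseteq> M \<and> 2 * card L < card H"
        and cov: "\<forall>e\<in>H - M. (\<exists>L\<in>\<L>. e \<in> L) \<or> (\<forall>d\<in>Q0. E e d \<longrightarrow> d = r)"
        by (elim exE conjE) (rule that)
      \<comment> \<open>The new dominating vertex h is not in \<open>Q0\<close>, so r and r' lie in
        \<open>nbh H\<close>, hence in Q. They are therefore adjacent to the clique Q that is now
        added to the spine.\<close>
      have rQ: "r \<in> Q0 \<inter> Q" "r' \<in> Q0 \<inter> Q" using IH(2,3) h(1) Q0H HQ(1) by blast+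
      let ?M = "M \<union> Q" and ?L = "\<L> \<union> (\<C> - {H})"
      have "\<forall>x\<in>?M. (x = r \<or> E x r) \<and> (x = r' \<or> E x r')"
        using Madj Qadj rQ by blast
      moreover have "?M \<subseteq> B \<union> nbh B"
        using IH(5) HQ(1,3) B(2) by (auto simp: Q_def)
      moreover have "\<forall>L\<in>?L. L \<noteq> {} \<and> conn L \<and> L \<subseteq> B - ?M \<and> clique (nbh L) \<and> nbh L \<subseteq> ?M \<and> 2 * card L < card B"
      proof
        fix L assume "L \<in> ?L"
        then show "L \<noteq> {} \<and> conn L \<and> L \<subseteq> B - ?M \<and> clique (nbh L) \<and> nbh L \<subseteq> ?M \<and> 2 * card L < card B"
        proof
          assume "L \<in> \<L>"
          from bspec[OF pieces this] show ?thesis using HQ(2,3) cardH by auto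
        next
          assume L: "L \<in> \<C> - {H}"
          then have LC: "L \<in> \<C>" by simp
          have "L \<inter> M = {}" using IH(5) disj[OF LC H] L HQ(1) comps(6)[OF LC] by blast
          then have "L \<subseteq> B - ?M" using comps(3,6)[OF LC] by (auto simp: U_def)
          then show ?thesis using comps[OF LC] light[OF L] by blast
        qed
      qed
      moreover have "\<forall>e\<in>B - ?M. (\<exists>L\<in>?L. e \<in> L) \<or> (\<forall>d\<in>Q0. E e d \<longrightarrow> d = r)"
      proof
        fix e assume e: "e \<in> B - ?M"
        then have "e \<in> U" by (auto simp: U_def Q_def)
        then obtain L where "L \<in> \<C>" "e \<in> L" using cover by blast
        then show "(\<exists>L\<in>?L. e \<in> L) \<or> (\<forall>d\<in>Q0. E e d \<longrightarrow> d = r)"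
          using cov e by (cases "L = H") auto
      qed
      ultimately show ?thesis using IH(1) rQ unfolding Q_def[symmetric]
        by (intro exI[of _ r] exI[of _ r'] exI[of _ ?M] exI[of _ ?L]) simp
    next
      case few: False
      \<comment> \<open>At the bottom r has to be the only vertex of \<open>Q0\<close> that H sees,
        if there is one; r' is any other vertex.\<close>
      have "\<exists>r r'. r \<noteq> r' \<and> r \<in> Q0 \<inter> Q \<and> r' \<in> Q0 \<inter> Q \<and> (\<forall>d\<in>Q0 \<inter> nbh H. d = r)"
      proof (cases "Q0 \<inter> nbh H = {}")
        case True
        then show ?thesis using x12 by (auto simp: Q_def)
      next
        case False
        then obtain r where r: "r \<in> Q0 \<inter> nbh H" by blast
        obtain r' where "r' \<in> Q0 \<inter> Q" "r' \<noteq> r" using x12 by (metis Q_def)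
        then show ?thesis using r few HQ(1) by blast
      qed
      then obtain r r' where r: "r \<noteq> r'" "r \<in> Q0 \<inter> Q" "r' \<in> Q0 \<inter> Q" and rH: "\<And>d. d \<in> Q0 \<inter> nbh H \<Longrightarrow> d = r"
        by blast
      \<comment> \<open>H may be too large for a piece and is left out. Its vertices satisfy the
        second alternative of the last clause, by the choice of r.\<close>
      let ?L = "\<C> - {H}"
      have "\<forall>x\<in>Q. (x = r \<or> E x r) \<and> (x = r' \<or> E x r')"
        using Qadj r by blast
      moreover have "Q \<subseteq> B \<union> nbh B" using B(2) by (auto simp: Q_def)
      moreover have "\<forall>L\<in>?L. L \<noteq> {} \<and> conn L \<and> L \<subseteq> B - Q \<and> clique (nbh L) \<and> nbh L \<subseteq> Q \<and> 2 * card L < card B"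
      proof
        fix L assume L: "L \<in> ?L"
        then have LC: "L \<in> \<C>" by simp
        have "L \<subseteq> B - Q" using comps(3,6)[OF LC] by (auto simp: U_def)
        then show "L \<noteq> {} \<and> conn L \<and> L \<subseteq> B - Q \<and> clique (nbh L) \<and> nbh L \<subseteq> Q \<and> 2 * card L < card B"
          using comps[OF LC] light[OF L] by blast
      qed
      moreover have "\<forall>e\<in>B - Q. (\<exists>L\<in>?L. e \<in> L) \<or> (\<forall>d\<in>Q0. E e d \<longrightarrow> d = r)"
      proof
        fix e assume e: "e \<in> B - Q"
        then have "e \<in> U" by (auto simp: U_def Q_def)
        then obtain L where L: "L \<in> \<C>" "e \<in> L" using cover by blast
        show "(\<exists>L\<in>?L. e \<in> L) \<or> (\<forall>d\<in>Q0. E e d \<longrightarrow> d = r)"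
        proof (cases "L = H")
          case True
          have "d = r" if "d \<in> Q0" "E e d" for d
          proof (rule rH)
            have "d \<notin> H" using Q0H that(1) by blast
            then show "d \<in> Q0 \<inter> nbh H" using that L True by (auto simp: nbh_def)
          qed
          then show ?thesis by blast
        next
          case False
          then show ?thesis using L by blast
        qed
      qed
      ultimately show ?thesis using r unfolding Q_def[symmetric]
        by (intro exI[of _ r] exI[of _ r'] exI[of _ Q] exI[of _ ?L]) simp
    qed
  qed
qed

section \<open>Ears and the rerouting of longest cycles\<close>

definition spine_structure :: "'a set \<Rightarrow> 'a set \<Rightarrow> 'a \<Rightarrow> 'a \<Rightarrow> 'a set \<Rightarrow> 'a set set \<Rightarrow> bool" where
  "spine_structure B Q r r' M \<L> \<longleftrightarrow> r \<noteq> r' \<and> r \<in> Q \<and> r' \<in> Q \<and> Q \<subseteq> M \<and> M \<subseteq> B \<union> nbh B \<and>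
    (\<forall>x\<in>M. (x = r \<or> E x r) \<and> (x = r' \<or> E x r')) \<and>
    (\<forall>L\<in>\<L>. L \<noteq> {} \<and> conn L \<and> L \<subseteq> B - M \<and> clique (nbh L) \<and> nbh L \<subseteq> M \<and> 2 * card L < card B) \<and>
    (\<forall>e\<in>B - M. (\<exists>L\<in>\<L>. e \<in> L) \<or> (\<forall>d\<in>Q. E e d \<longrightarrow> d = r))"

lemma spine_structureD:
  assumes "spine_structure B Q r r' M \<L>"
  shows "r \<noteq> r'" "r \<in> Q" "r' \<in> Q" "Q \<subseteq> M"
    "\<And>x. x \<in> M \<Longrightarrow> x = r \<or> E x r" "\<And>x. x \<in> M \<Longrightarrow> x = r' \<or> E x r'"
    "\<And>L. L \<in> \<L> \<Longrightarrow> L \<noteq> {} \<and> conn L \<and> L \<subseteq> B - M \<and> clique (nbh L) \<and> nbh L \<subseteq> M \<and> 2 * card L < card B"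
    "\<And>e d. e \<in> B - M \<Longrightarrow> d \<in> Q \<Longrightarrow> E e d \<Longrightarrow> d \<noteq> r \<Longrightarrow> \<exists>L\<in>\<L>. e \<in> L"
proof -
  note a = assms[unfolded spine_structure_def]
  show "r \<noteq> r'" using a by (elim conjE)
  show "r \<in> Q" using a by (elim conjE)
  show "r' \<in> Q" using a by (elim conjE)
  show "Q \<subseteq> M" using a by (elim conjE)
  have m: "\<forall>x\<in>M. (x = r \<or> E x r) \<and> (x = r' \<or> E x r')" using a by (elim conjE)
  show "x = r \<or> E x r" "x = r' \<or> E x r'" if "x \<in> M" for x using bspec[OF m that] by simp_all
  show "L \<noteq> {} \<and> conn L \<and> L \<subseteq> B - M \<and> clique (nbh L) \<and> nbh L \<subseteq> M \<and> 2 * card L < card B"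
    if "L \<in> \<L>" for L using a that by (elim conjE) (rule bspec)
  have c: "\<forall>e\<in>B - M. (\<exists>L\<in>\<L>. e \<in> L) \<or> (\<forall>d\<in>Q. E e d \<longrightarrow> d = r)" using a by (elim conjE)
  show "\<exists>L\<in>\<L>. e \<in> L" if "e \<in> B - M" "d \<in> Q" "E e d" "d \<noteq> r" for e d
    using bspec[OF c that(1)] that(2-4) by blast
qed

text \<open>The attachment vertices u and w stay outside the list, so its length counts vertices of
  L only and compares directly with the run of a cycle inside a component.\<close>

definition ear :: "'a set \<Rightarrow> 'a \<Rightarrow> 'a list \<Rightarrow> 'a \<Rightarrow> bool" where
  "ear L u P w \<longleftrightarrow> is_walk P \<and> distinct P \<and> set P \<subseteq> L \<and> u \<in> nbh L \<and> w \<in> nbh L \<and> u \<noteq> w \<and>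
    E u (hd P) \<and> E (last P) w"

lemma ear_rev: "ear L u P w \<Longrightarrow> ear L w (rev P) u"
proof -
  assume e: "ear L u P w"
  then have "P \<noteq> []" by (simp add: ear_def is_walk_def)
  then show ?thesis using e E_sym[of u "hd P"] E_sym[of "last P" w]
    by (auto simp: ear_def is_walk_rev hd_rev last_rev)
qed

lemma longest_cong: "longest xs \<Longrightarrow> is_cycle ys \<Longrightarrow> length ys = length xs \<Longrightarrow> longest ys"
  by (simp add: longest_def)

text \<open>The cycle enters B at a vertex e coming from d in \<open>nbh B\<close>. Maximality of
  the cycle forces e into a piece L, and a maximal run of the cycle inside L is the required
  ear.\<close>

lemma cycle_has_light_segment:
  assumes sp: "spine_structure B (insert v (nbh B)) r r' M \<L>" and v: "v \<in> B"
    and C: "longest C" "set C \<inter> B \<noteq> {}" "r \<notin> set C"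
    and x12: "x1 \<in> set C \<inter> insert v (nbh B)" "x2 \<in> set C \<inter> insert v (nbh B)" "x1 \<noteq> x2"
  obtains ys zs L where "longest (ys @ zs)" "set (ys @ zs) = set C" "zs \<noteq> []" "L \<in> \<L>" "ear L (last zs) ys (hd zs)"
proof -
  let ?Q = "insert v (nbh B)"
  note QM = spine_structureD(4)[OF sp] and Madj = spine_structureD(5)[OF sp]
    and pieces = spine_structureD(7)[OF sp] and cov = spine_structureD(8)[OF sp]
  have cyc: "is_cycle C" using C(1) by (simp add: longest_def)
  have nB: "\<not> set C \<subseteq> B" using x12 by (auto simp: nbh_def)
  obtain ys zs where yz: "is_cycle (ys @ zs)" "set (ys @ zs) = set C" "length (ys @ zs) = length C"
    "ys \<noteq> []" "zs \<noteq> []" "set ys \<subseteq> B" "hd zs \<notin> B" "last zs \<notin> B"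
    by (rule cycle_segment[OF cyc C(2) nB])
  define e d where "e = hd ys" and "d = last zs"
  have ed: "E d e" using yz(1) is_cycle_append_iff[OF yz(4,5)] by (simp add: e_def d_def)
  have eB: "e \<in> B" unfolding e_def using yz(6) hd_in_set[OF yz(4)] by (rule subsetD)
  have "hd ys \<in> set (ys @ zs)" "last zs \<in> set (ys @ zs)" using yz(4,5) by simp_all
  then have inC: "e \<in> set C" "d \<in> set C" by (simp_all only: yz(2) e_def d_def)
  have dQ: "d \<in> nbh B" using E_sym[OF ed] eB yz(8) by (auto simp: nbh_def d_def)
  then have dM: "d \<in> M" using QM by blast
  have dr: "d \<noteq> r" "e \<noteq> r" using inC C(3) by auto
  \<comment> \<open>Otherwise the consecutive vertices d and e would both be adjacent to r, which
    could be inserted between them.\<close>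
  have "e \<notin> M"
  proof
    assume "e \<in> M"
    then have er: "E e r" using Madj[of e] dr by blast
    have "E d r" using Madj[OF dM] dr by blast
    moreover have "r \<notin> set (ys @ zs)" using C(3) by (simp only: yz(2) not_False_eq_True)
    ultimately show False
      using longest_no_insert[OF longest_cong[OF C(1) yz(1,3)] yz(4,5), of r] E_sym[OF er]
      by (simp add: e_def d_def)
  qed
  then obtain L where L: "L \<in> \<L>" "e \<in> L" using cov[of e d] eB dQ E_sym[OF ed] dr(1) by blast
  have LM: "L \<inter> M = {}" "nbh L \<subseteq> M" using pieces[OF L(1)] by blast+
  have iL: "set C \<inter> L \<noteq> {}" "\<not> set C \<subseteq> L" using inC L(2) LM(1) dM by blast+
  obtain us ws where uw: "is_cycle (us @ ws)" "set (us @ ws) = set C" "length (us @ ws) = length C"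
    "us \<noteq> []" "ws \<noteq> []" "set us \<subseteq> L" "hd ws \<notin> L" "last ws \<notin> L"
    by (rule cycle_segment[OF cyc iL])
  have adj: "E (last us) (hd ws)" "E (last ws) (hd us)" "is_walk us" "distinct (us @ ws)"
    using uw(1) is_cycle_append_iff[OF uw(4,5)] by simp_all
  have usL: "last us \<in> L" "hd us \<in> L" using uw(4,6) by auto
  have nbs: "hd ws \<in> nbh L" "last ws \<in> nbh L"
    using adj(1) E_sym[OF adj(2)] usL uw(7,8) by (auto simp: nbh_def)
  \<comment> \<open>If they coincide, the cycle lies in L apart from one vertex, yet it contains two
    vertices of the clique, which is disjoint from L.\<close>
  have "hd ws \<noteq> last ws"
  proof
    assume eq: "hd ws = last ws"
    obtain w ws' where ws: "ws = w # ws'" using uw(5) by (cases ws) auto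
    have "ws' = []"
    proof (rule ccontr)
      assume "ws' \<noteq> []"
      then have "w \<in> set ws'" using eq ws last_in_set[of ws'] by simp
      then show False using adj(4) ws by simp
    qed
    then have "set (us @ ws) \<subseteq> insert w L" using uw(6) ws by auto
    then have "set C \<subseteq> insert w L" by (simp only: uw(2))
    moreover have "?Q \<inter> L = {}" using LM(1) QM by blast
    ultimately have "x1 = w" "x2 = w" using x12 by blast+
    then show False using x12(3) by simp
  qed
  then have "ear L (last ws) us (hd ws)"
    using adj nbs uw(6) by (simp add: ear_def)
  then show thesis using that[of us ws L] longest_cong[OF C(1) uw(1,3)] uw(2,5) L(1) by blast
qed

text \<open>Both ends of zs lie in M and are adjacent to r and r'. So ys can be exchanged for a path
  W from r to r' through the longer ear, unless the cycle meets L.\<close>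

lemma longer_ear_hits:
  assumes sp: "spine_structure B Q r r' M \<L>"
    and ear: "ear L u P w" "L \<in> \<L>" and C: "longest (ys @ zs)" "zs \<noteq> []"
    and L': "L' \<in> \<L>" "ear L' (last zs) ys (hd zs)"
    and len: "length ys \<le> length P"
    and avoid: "set (ys @ zs) \<inter> {r, r', u, w} = {}"
  shows "set (ys @ zs) \<inter> L \<noteq> {}"
proof
  assume CL: "set (ys @ zs) \<inter> L = {}"
  have rM: "r \<in> M" "r' \<in> M" "r \<noteq> r'" using spine_structureD(1-4)[OF sp] by blast+
  note Madj = spine_structureD(5,6)[OF sp] and pieces = spine_structureD(7)[OF sp]
  \<comment> \<open>The ear is reversed if necessary, so that r can precede it and r' can follow it
    without a repetition.\<close>
  have "\<exists>u' P' w'. ear L u' P' w' \<and> length P' = length P \<and> {u', w'} = {u, w} \<and> u' \<noteq> r' \<and> w' \<noteq> r"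
  proof (cases "u = r' \<or> w = r")
    case True
    have "u \<noteq> w" using ear(1) by (simp add: ear_def)
    then have "w \<noteq> r' \<and> u \<noteq> r" using True rM(3) by auto
    then show ?thesis using ear_rev[OF ear(1)]
      by (intro exI[of _ w] exI[of _ "rev P"] exI[of _ u]) auto
  next
    case False
    then show ?thesis using ear(1) by blast
  qed
  then obtain a R b where R: "ear L a R b" and lenR: "length R = length P"
    and ab: "{a, b} = {u, w}" and ar: "a \<noteq> r'" "b \<noteq> r" by blast
  have LM: "L \<inter> M = {}" "nbh L \<subseteq> M" and L'M: "nbh L' \<subseteq> M" using pieces[OF ear(2)] pieces[OF L'(1)] by blast+
  have e: "is_walk R" "distinct R" "set R \<subseteq> L" "a \<in> M" "b \<in> M" "a \<noteq> b" "E a (hd R)" "E (last R) b" "R \<noteq> []"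
    using R LM by (auto simp: ear_def is_walk_def)
  have zM: "hd zs \<in> M" "last zs \<in> M" using L'(2) L'M by (auto simp: ear_def)
  have zC: "hd zs \<in> set (ys @ zs)" "last zs \<in> set (ys @ zs)" using C(2) by auto
  \<comment> \<open>If the ear already starts in r or ends in r', nothing is added on that
    side.\<close>
  define as bs where "as = (if a = r then [] else [r])" and "bs = (if b = r' then [] else [r'])"
  define W where "W = as @ (a # R @ [b]) @ bs"
  have rE: "E r x" if "x \<in> M" "x \<noteq> r" for x using Madj(1)[OF that(1)] that(2) E_sym by blast
  have rE': "E x r'" if "x \<in> M" "x \<noteq> r'" for x using Madj(2)[OF that(1)] that(2) by blast
  have inner: "successively E (a # R @ [b])"
    using e by (auto simp: is_walk_def successively_append_iff successively_Cons)
  have W: "is_walk W"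
    using inner rE[of a] rE'[of b] e(4,5,9)
    by (auto simp: is_walk_def successively_append_iff successively_Cons hd_append W_def as_def bs_def)
  have hW: "hd W = r" "last W = r'" by (auto simp: W_def as_def bs_def)
  have setW: "set W \<subseteq> L \<union> {r, r', a, b}" using e(3) by (auto simp: W_def as_def bs_def)
  have "distinct W" using e ar rM LM(1) by (auto simp: W_def as_def bs_def)
  moreover have "set W \<inter> set zs = {}"
  proof -
    have "set zs \<inter> (L \<union> {r, r', a, b}) = {}" using CL avoid ab by auto
    then show ?thesis using setW by blast
  qed
  moreover have cyc: "is_cycle (ys @ zs)" using C(1) by (simp add: longest_def)
  then have zs: "is_walk zs" "distinct zs" using C(2)
    by (auto simp: is_cycle_def is_walk_def successively_append_iff)
  moreover have "E (last zs) r" using Madj(1)[OF zM(2)] zC(2) avoid by auto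
  moreover have "E r' (hd zs)"
  proof -
    have "hd zs \<noteq> r'" using zC(1) avoid by auto
    then show ?thesis using rE'[OF zM(1)] E_sym by blast
  qed
  moreover have "3 \<le> length (W @ zs)" using e(9) by (cases R) (auto simp: W_def)
  moreover have Wne: "W \<noteq> []" by (simp add: W_def)
  ultimately have "is_cycle (W @ zs)"
    using W hW is_cycle_append_iff[OF Wne C(2)] by (simp only: distinct_append)
  \<comment> \<open>But W contains a, R and b, so it has at least two more vertices than ys.\<close>
  then have "length (W @ zs) \<le> length (ys @ zs)" using C(1) by (simp only: longest_def)
  then show False using len lenR by (simp add: W_def)
qed

end

section \<open>Halving the set hit by the uncovered cycles\<close>

locale two_connected_chordal_ugraph = chordal_ugraph +
  assumes conn_V: "conn V" and conn_remove: "conn (V - {z})"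
begin

text \<open>F holds the longest cycles still to be hit and k is the budget of rounds. The induction
  is on the size of B because a passage to a smaller set at no cost keeps F and k; only a halving
  changes them.\<close>

lemma transversal_of_hitting:
  assumes "conn B" "B \<noteq> {}" "B \<subseteq> V" "clique (nbh B)"
    and "\<forall>C\<in>F. longest C \<and> set C \<inter> B \<noteq> {}" "card B < 2 ^ k"
  shows "\<exists>S. S \<subseteq> V \<and> card S \<le> 4 * k \<and> (\<forall>C\<in>F. set C \<inter> S \<noteq> {})"
  using assms
proof (induction "card B" arbitrary: B F k rule: less_induct)
  case less
  note B = less.prems(1-4) and F = less.prems(5) and Bk = less.prems(6)
  have finB: "finite B" using B(3) finite_V finite_subset by blast
  obtain v where v: "v \<in> B" "\<forall>y\<in>nbh B. E v y"
    by (rule clique_nbh_dominated[OF B])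
  define Q where "Q = insert v (nbh B)"
  have QV: "Q \<subseteq> V" using v(1) B(3) nbh_subset_V by (auto simp: Q_def)
  have cQ: "clique Q" using B(4) v(2) E_sym by (auto simp: clique_def Q_def)
  have QB: "Q \<inter> B = {v}" using v(1) by (auto simp: Q_def nbh_def)
  show ?case
  proof (cases "\<exists>C\<in>F. \<forall>x\<in>set C \<inter> Q. \<forall>y\<in>set C \<inter> Q. x = y")
    case True
    then obtain C0 where C0: "C0 \<in> F" and one: "\<And>x y. x \<in> set C0 \<inter> Q \<Longrightarrow> y \<in> set C0 \<inter> Q \<Longrightarrow> x = y"
      by blast
    have lC0: "longest C0" "set C0 \<inter> B \<noteq> {}" using F C0 by auto
    then have cyc: "is_cycle C0" by (simp add: longest_def)
    \<comment> \<open>Otherwise the cycle meets B in v alone, a neighbour of v on it lies in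
      \<open>nbh B\<close>, and two vertices of Q are on the cycle.\<close>
    have "\<exists>w. w \<in> set C0 \<inter> (B - {v})"
    proof (rule ccontr)
      assume n: "\<not> ?thesis"
      then have vC: "v \<in> set C0" using lC0(2) by blast
      have nv: "\<not> set C0 \<subseteq> {v}"
      proof
        assume "set C0 \<subseteq> {v}"
        then have "card (set C0) \<le> 1" using card_mono[of "{v}" "set C0"] by simp
        then show False using cyc by (simp add: is_cycle_def distinct_card)
      qed
      have "set C0 \<inter> {v} \<noteq> {}" using vC by blast
      then obtain ys zs where yz: "is_cycle (ys @ zs)" "set (ys @ zs) = set C0"
        "ys \<noteq> []" "zs \<noteq> []" "set ys \<subseteq> {v}" "last zs \<notin> {v}"
        by (rule cycle_segment[OF cyc _ nv])
      have hv: "hd ys = v" using yz(5) hd_in_set[OF yz(3)] by blast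
      have "E (last zs) (hd ys)" using yz(1) is_cycle_append_iff[OF yz(3,4)] by simp
      then have "E v (last zs)" unfolding hv by (rule E_sym)
      moreover have "last zs \<in> set (ys @ zs)" using yz(4) by simp
      then have "last zs \<in> set C0" by (simp only: yz(2))
      moreover from this have "last zs \<notin> B" using n yz(6) by blast
      ultimately have "last zs \<in> set C0 \<inter> Q" using v(1) by (auto simp: Q_def nbh_def)
      moreover have "v \<in> set C0 \<inter> Q" using vC by (simp add: Q_def)
      ultimately show False using one yz(6) by blast
    qed
    then obtain w where w: "w \<in> set C0" "w \<in> B - {v}" by blast
    define L where "L = comp (B - {v}) w"
    have L: "w \<in> L" "conn L" "L \<subseteq> B - {v}" "nbh L \<subseteq> Q"
      using comp_self[OF w(2)] comp_conn comp_subset nbh_comp_remove[OF v(1)]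
      by (auto simp: L_def Q_def)
    \<comment> \<open>A run inside L is bounded by vertices of \<open>nbh L\<close>, hence of Q. By
      assumption they are the same vertex, and this is all of the cycle outside L.\<close>
    have C0L: "set C0 - Q \<subseteq> L"
    proof (cases "set C0 \<subseteq> L")
      case nL: False
      have "set C0 \<inter> L \<noteq> {}" using w(1) L(1) by blast
      then obtain ys zs where yz: "is_cycle (ys @ zs)" "set (ys @ zs) = set C0"
        "length (ys @ zs) = length C0" "ys \<noteq> []" "zs \<noteq> []" "set ys \<subseteq> L" "hd zs \<notin> L" "last zs \<notin> L"
        by (rule cycle_segment[OF cyc _ nL])
      have adj: "E (last ys) (hd zs)" "E (last zs) (hd ys)" "distinct zs"
        using yz(1) is_cycle_append_iff[OF yz(4,5)] by simp_all
      have "last ys \<in> L" "hd ys \<in> L" using yz(4,6) by auto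
      then have "hd zs \<in> nbh L" "last zs \<in> nbh L"
        using adj(1) E_sym[OF adj(2)] yz(7,8) by (auto simp: nbh_def)
      moreover have "hd zs \<in> set (ys @ zs)" "last zs \<in> set (ys @ zs)" using yz(5) by simp_all
      ultimately have q: "hd zs \<in> set C0 \<inter> Q" "last zs \<in> set C0 \<inter> Q"
        unfolding yz(2) using L(4) by blast+
      have "zs = [hd zs]"
      proof -
        obtain z zs' where zs: "zs = z # zs'" using yz(5) by (cases zs) auto
        have "last zs = z" using one[OF q(2,1)] zs by simp
        then have "zs' = []" using adj(3) zs last_in_set[of zs'] by (cases "zs' = []") auto
        then show ?thesis using zs by simp
      qed
      then have "set zs = {hd zs}" by (metis list.simps(15) empty_set)
      then have "set zs \<subseteq> Q" using q(1) by simp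
      then have "set (ys @ zs) - Q \<subseteq> L" using yz(6) by auto
      then show ?thesis by (simp only: yz(2))
    qed blast
    \<comment> \<open>Of two vertices shared with C0 at most one is in Q, so the other one is in
      L.\<close>
    have hit: "\<forall>C\<in>F. longest C \<and> set C \<inter> L \<noteq> {}"
    proof
      fix C assume C: "C \<in> F"
      then have lC: "longest C" using F by blast
      obtain a b where ab: "a \<in> set C0 \<inter> set C" "b \<in> set C0 \<inter> set C" "a \<noteq> b"
        by (rule longest_cycles_share_two[OF conn_remove conn_V lC0(1) lC])
      then have "a \<notin> Q \<or> b \<notin> Q" using one by blast
      then have "set C \<inter> L \<noteq> {}" using ab C0L by blast
      then show "longest C \<and> set C \<inter> L \<noteq> {}" using lC by simp
    qed
    have LB: "L \<subset> B" using L(3) v(1) by blast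
    then have cL: "card L < card B" using finB by (simp add: psubset_card_mono)
    have "clique (nbh L)" using L(4) cQ by (auto simp: clique_def)
    moreover have "L \<noteq> {}" "L \<subseteq> V" using L(1) LB B(3) by blast+
    moreover have "card L < 2 ^ k" using cL Bk by simp
    ultimately show ?thesis using less.hyps[OF cL L(2) _ _ _ hit] by blast
  next
    case False
    then have two: "\<exists>x y. x \<in> set C \<inter> Q \<and> y \<in> set C \<inter> Q \<and> x \<noteq> y" if "C \<in> F" for C
      using that by blast
    show ?thesis
    proof (cases "F = {}")
      case True
      then show ?thesis by (intro exI[of _ "{}"]) simp
    next
      case False
      then obtain C where "C \<in> F" by blast
      then obtain x y where xy: "x \<in> Q" "y \<in> Q" "x \<noteq> y" using two[of C] by blast
      have "Q \<inter> B \<subseteq> {v}" using QB by simp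
      \<comment> \<open>The descent starts with Q itself in the role of \<open>Q0\<close>.\<close>
      then have "\<exists>r r' M \<L>. spine_structure B Q r r' M \<L>"
        unfolding spine_structure_def
        by (rule spine_decomposition[OF B(1) v(1) B(3) v(2) B(4), of Q x y, folded Q_def, unfolded Int_absorb, OF _ xy])
      then obtain r r' M \<L> where sp: "spine_structure B Q r r' M \<L>" by blast
      have rQ: "r \<in> Q" "r' \<in> Q" using spine_structureD(2,3)[OF sp] by auto
      have k0: "k \<noteq> 0"
      proof
        assume "k = 0"
        then have "card B = 0" using Bk by simp
        then show False using finB B(2) by simp
      qed
      then obtain k' where k': "k = Suc k'" by (cases k) auto
      have seg: "\<exists>ys zs L. longest (ys @ zs) \<and> set (ys @ zs) = set C \<and> zs \<noteq> [] \<and> L \<in> \<L> \<and> ear L (last zs) ys (hd zs)"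
        if C: "C \<in> F" "r \<notin> set C" for C
      proof -
        obtain x y where xy: "x \<in> set C \<inter> insert v (nbh B)" "y \<in> set C \<inter> insert v (nbh B)" "x \<noteq> y"
          using two[OF C(1)] by (auto simp: Q_def)
        have lC: "longest C" "set C \<inter> B \<noteq> {}" using F C(1) by auto
        show ?thesis
          by (rule cycle_has_light_segment[OF sp[unfolded Q_def] v(1) lC C(2) xy]) blast
      qed
      define ears where "ears = {(L, u, P, w). L \<in> \<L> \<and> ear L u P w}"
      show ?thesis
      proof (cases "ears = {}")
        case True
        \<comment> \<open>Without ears, \<open>seg\<close> puts r on every cycle of F.\<close>
        have "set C \<inter> {r, r'} \<noteq> {}" if "C \<in> F" for C
        proof (rule ccontr)
          assume "\<not> ?thesis"
          then have "r \<notin> set C" by simp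
          from seg[OF that this] True show False unfolding ears_def by blast
        qed
        moreover have "card {r, r'} \<le> 4 * k" using k0 by (auto simp: card_insert_if)
        ultimately show ?thesis using rQ QV by (intro exI[of _ "{r, r'}"]) auto
      next
        case False
        have bound: "length P \<le> card V" if "(L, u, P, w) \<in> ears" for L u P w
        proof -
          have "L \<in> \<L>" "distinct P" "set P \<subseteq> L" using that by (auto simp: ears_def ear_def)
          moreover then have "L \<subseteq> B" using spine_structureD(7)[OF sp, of L] by blast
          ultimately have "set P \<subseteq> V" using B(3) by blast
          then show ?thesis using distinct_card[OF \<open>distinct P\<close>] card_mono[OF finite_V] by metis
        qed
        \<comment> \<open>The ear is chosen longest among all pieces, since it must be compared with
          the crossings of other pieces.\<close>
        define f where "f t = length (fst (snd (snd t)))" for t :: "'a set \<times> 'a \<times> 'a list \<times> 'a"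
        have "f ` ears \<subseteq> {..card V}" using bound by (force simp: f_def)
        then have fin: "finite (f ` ears)" by (rule finite_subset) simp
        then have "Max (f ` ears) \<in> f ` ears" using False by (intro Max_in) auto
        then obtain t where t: "t \<in> ears" and ft: "f t = Max (f ` ears)" by auto
        have tmax: "f s \<le> f t" if "s \<in> ears" for s
          unfolding ft using fin that by (intro Max_ge) auto
        obtain L u P w where t_eq: "t = (L, u, P, w)" by (cases t)
        have LP: "L \<in> \<L>" "ear L u P w" using t t_eq by (auto simp: ears_def)
        have L: "L \<noteq> {}" "conn L" "L \<subseteq> B" "clique (nbh L)" "2 * card L < card B"
          using spine_structureD(7)[OF sp LP(1)] by blast+
        \<comment> \<open>Cycles through one of the four vertices are hit. Every other one has a
          crossing no longer than P, and therefore meets L.\<close>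
        define F' where "F' = {C \<in> F. set C \<inter> {r, r', u, w} = {}}"
        have "\<forall>C\<in>F'. longest C \<and> set C \<inter> L \<noteq> {}"
        proof
          fix C assume "C \<in> F'"
          then have C: "C \<in> F" "set C \<inter> {r, r', u, w} = {}" by (auto simp: F'_def)
          then have "r \<notin> set C" by simp
          from seg[OF C(1) this] obtain ys zs L' where s: "longest (ys @ zs)" "set (ys @ zs) = set C"
            "zs \<noteq> []" "L' \<in> \<L>" "ear L' (last zs) ys (hd zs)" by blast
          have "(L', last zs, ys, hd zs) \<in> ears" using s by (simp add: ears_def)
          from tmax[OF this] have "length ys \<le> length P" by (simp add: t_eq f_def)
          from longer_ear_hits[OF sp LP(2,1) s(1,3,4,5) this] have "set C \<inter> L \<noteq> {}"
            unfolding s(2) using C(2) by blast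
          then show "longest C \<and> set C \<inter> L \<noteq> {}" using F C(1) by blast
        qed
        \<comment> \<open>Since \<open>2 * card L < card B\<close>, the exponent drops by one, which
          pays for the four vertices.\<close>
        moreover have "card L < card B" "L \<subseteq> V" "card L < 2 ^ k'"
          using L(3,5) B(3) Bk k' by auto
        ultimately obtain S where S: "S \<subseteq> V" "card S \<le> 4 * k'" "\<forall>C\<in>F'. set C \<inter> S \<noteq> {}"
          using less.hyps[of L F' k'] L by blast
        have uw: "{u, w} \<subseteq> V" using LP(2) nbh_subset_V by (auto simp: ear_def)
        have "card ({r, r', u, w} \<union> S) \<le> card {r, r', u, w} + card S" by (rule card_Un_le)
        also have "card {r, r', u, w} \<le> 4" by (auto simp: card_insert_if)
        finally have "card ({r, r', u, w} \<union> S) \<le> 4 * k" using S(2) k' by simp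
        moreover have "\<forall>C\<in>F. set C \<inter> ({r, r', u, w} \<union> S) \<noteq> {}"
        proof
          fix C assume "C \<in> F"
          then show "set C \<inter> ({r, r', u, w} \<union> S) \<noteq> {}"
            using S(3) by (cases "C \<in> F'") (auto simp: F'_def)
        qed
        moreover have "{r, r', u, w} \<union> S \<subseteq> V" using rQ QV uw S(1) by blast
        ultimately show ?thesis by blast
      qed
    qed
  qed
qed

text \<open>The halving starts with all of V, whose neighbourhood is empty and thus a
  clique.\<close>

lemma longest_cycle_transversal_log:
  assumes "V \<noteq> {}" "card V < 2 ^ k"
  shows "\<exists>S. S \<subseteq> V \<and> card S \<le> 4 * k \<and> (\<forall>C. longest C \<longrightarrow> set C \<inter> S \<noteq> {})"
proof -
  have "nbh V = {}" using E_in_V by (auto simp: nbh_def)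
  then have cl: "clique (nbh V)" by (simp add: clique_def)
  have hit: "\<forall>C\<in>Collect longest. longest C \<and> set C \<inter> V \<noteq> {}"
  proof
    fix C assume "C \<in> Collect longest"
    then have C: "longest C" by simp
    then have "is_cycle C" by (simp add: longest_def)
    then have "set C \<subseteq> V" "C \<noteq> []" using cycle_in_V[of C] by (auto simp: is_cycle_def)
    then have "set C \<subseteq> V" "set C \<noteq> {}" by simp_all
    then show "longest C \<and> set C \<inter> V \<noteq> {}" using C by (simp add: Int_absorb2)
  qed
  from transversal_of_hitting[OF conn_V assms(1) order_refl cl hit assms(2)]
  show ?thesis by simp
qed

end

section \<open>Translation from digraphs\<close>

context graph
begin

abbreviation adj :: "'a \<Rightarrow> 'a \<Rightarrow> bool" where
  "adj u v \<equiv> (u, v) \<in> arcs_ends G"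

lemma ugraph_adj: "ugraph (verts G) adj"
  by unfold_locales (auto dest: adj_in_verts graph_symmetric adj_not_same)

interpretation U: ugraph "verts G" adj
  by (rule ugraph_adj)

lemma successively_tails:
  "cas u p v \<Longrightarrow> set p \<subseteq> arcs G \<Longrightarrow> successively adj (map (tail G) p @ [v]) \<and> hd (map (tail G) p @ [v]) = u"
  by (induction p arbitrary: u) (auto simp: successively_Cons intro: in_arcs_imp_in_arcs_ends)

lemma heads_of_cas: "cas u p v \<Longrightarrow> p \<noteq> [] \<Longrightarrow> map (head G) p = tl (map (tail G) p) @ [v]"
proof (induction p arbitrary: u)
  case (Cons e p)
  then show ?case by (cases p) auto
qed simp

lemma arcs_of_walk:
  "successively adj (xs @ [v]) \<Longrightarrow> xs \<noteq> [] \<Longrightarrow>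
    \<exists>p. set p \<subseteq> arcs G \<and> map (tail G) p = xs \<and> cas (hd xs) p v"
proof (induction xs)
  case (Cons x xs)
  show ?case
  proof (cases "xs = []")
    case True
    then have "adj x v" using Cons.prems by simp
    then obtain e where "e \<in> arcs G" "tail G e = x" "head G e = v" by auto
    then show ?thesis using True by (intro exI[of _ "[e]"]) simp
  next
    case False
    then have "adj x (hd xs)" "successively adj (xs @ [v])"
      using Cons.prems by (auto simp: successively_Cons)
    moreover obtain e where "e \<in> arcs G" "tail G e = x" "head G e = hd xs"
      using calculation(1) by auto
    moreover obtain p where "set p \<subseteq> arcs G" "map (tail G) p = xs" "cas (hd xs) p v"
      using Cons.IH calculation(2) False by blast
    ultimately show ?thesis by (intro exI[of _ "e # p"]) simp
  qed
qed simp

lemma is_cycle_tails: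
  assumes "graph_cycle G p" shows "U.is_cycle (map (tail G) p)"
proof -
  obtain u where u: "awalk u p u" "distinct (tl (awalk_verts u p))" "p \<noteq> []" "3 \<le> length p"
    using assms by (auto simp: graph_cycle_def cycle_def)
  then have c: "cas u p u" "set p \<subseteq> arcs G" by (auto simp: awalk_def)
  have s: "successively adj (map (tail G) p @ [u])" "hd (map (tail G) p) = u"
    using successively_tails[OF c] u(3) by auto
  have "tail G (hd p) = u" using s(2) u(3) by (simp add: hd_map)
  then have t: "map (tail G) p = u # map (tail G) (tl p)" using u(3) by (cases p) auto
  have "head G (last p) = u" using c(1) u(3) awlast_if_cas[OF c(1)] by (simp add: awalk_verts_conv)
  \<comment> \<open>The closed walk lists u at both ends. Without the first entry it is the list of
    tails rotated by one, so distinctness carries over.\<close>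
  then have "tl (awalk_verts u p) = map (tail G) (tl p) @ [u]"
    using u(3) t by (simp add: awalk_verts_conv)
  then have "distinct (map (tail G) p)" using u(2) t by simp
  then show ?thesis using s u(3,4) unfolding U.is_cycle_def
    by (auto simp: successively_append_iff)
qed

lemma graph_cycle_of_is_cycle:
  assumes xs: "U.is_cycle xs"
  obtains p where "graph_cycle G p" "map (tail G) p = xs" "cas (hd xs) p (hd xs)" "set p \<subseteq> arcs G"
proof -
  have ne: "xs \<noteq> []" using xs by (auto simp: U.is_cycle_def)
  have "successively adj (xs @ [hd xs])"
    using xs by (auto simp: U.is_cycle_def successively_append_iff)
  then obtain p where p: "set p \<subseteq> arcs G" "map (tail G) p = xs" "cas (hd xs) p (hd xs)"
    using arcs_of_walk ne by blast
  have pne: "p \<noteq> []" using p(2) ne by auto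
  have "hd xs \<in> verts G" using U.cycle_in_V[OF xs] hd_in_set[OF ne] by blast
  then have "awalk (hd xs) p (hd xs)" using p by (simp add: awalk_def)
  moreover have "awalk_verts (hd xs) p = xs @ [hd xs]"
    using p(2) pne awlast_if_cas[OF p(3)] by (simp add: awalk_verts_conv)
  then have "distinct (tl (awalk_verts (hd xs) p))"
    using xs ne by (cases xs) (auto simp: U.is_cycle_def)
  moreover have "length p = length xs" using p(2) by auto
  then have "3 \<le> length p" using xs by (simp add: U.is_cycle_def)
  ultimately have "graph_cycle G p" using pne by (auto simp: graph_cycle_def cycle_def)
  then show thesis using that p by blast
qed

lemma chordal_ugraph_adj:
  assumes "chordal G" shows "chordal_ugraph (verts G) adj"
proof unfold_locales
  fix xs assume xs: "U.is_cycle xs" and len: "4 \<le> length xs"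
  obtain p where p: "graph_cycle G p" "map (tail G) p = xs" "cas (hd xs) p (hd xs)"
    by (rule graph_cycle_of_is_cycle[OF xs])
  have pne: "p \<noteq> []" and lp: "length p = length xs" using p(2) len by auto
  have cv: "cycle_verts G p = set xs" using p(2) by (auto simp: cycle_verts_def)
  moreover have "card (set xs) = length xs" using xs by (simp add: U.is_cycle_def distinct_card)
  ultimately have "has_chord G p" using assms p(1) len by (simp add: chordal_def)
  then obtain u v where uv: "u \<in> set xs" "v \<in> set xs" "adj u v"
    "(u, v) \<notin> arc_to_ends G ` set p" "(v, u) \<notin> arc_to_ends G ` set p"
    by (auto simp: has_chord_def cv)
  \<comment> \<open>The head of each arc is the tail of the next one; \<open>tl xs @ [hd xs]\<close>
    is the cycle shifted by one place with wrap-around.\<close>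
  have ends: "arc_to_ends G (p ! i) = (xs ! i, (tl xs @ [hd xs]) ! i)" if "i < length xs" for i
  proof -
    have "head G (p ! i) = map (head G) p ! i" using that lp by simp
    also have "\<dots> = (tl xs @ [hd xs]) ! i" using heads_of_cas[OF p(3) pne] p(2) by simp
    finally have "head G (p ! i) = (tl xs @ [hd xs]) ! i" .
    moreover have "tail G (p ! i) = xs ! i" using that lp p(2) by (metis nth_map)
    ultimately show ?thesis by (simp add: arc_to_ends_def)
  qed
  have no_arc: "(xs ! i, (tl xs @ [hd xs]) ! i) \<notin> {(u, v), (v, u)}" if "i < length xs" for i
  proof -
    have "p ! i \<in> set p" using that lp by simp
    then show ?thesis using uv(4,5) ends[OF that] by (metis empty_iff imageI insertE)
  qed
  obtain i j where ij: "i < length xs" "j < length xs" "u = xs ! i" "v = xs ! j"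
    using uv(1,2) by (metis in_set_conv_nth)
  \<comment> \<open>Positions that are consecutive on the cycle, including the first and the last,
    would make u and v the ends of an arc of p.\<close>
  have chord: "Suc a < b \<and> \<not> (a = 0 \<and> Suc b = length xs)"
    if ab: "a < b" "b < length xs" and e: "{xs ! a, xs ! b} = {u, v}" for a b
  proof -
    have "xs \<noteq> []" using len by auto
    have "b \<noteq> Suc a"
    proof
      assume "b = Suc a"
      moreover from this have "a < length (tl xs)" using ab(2) by simp
      ultimately have "(tl xs @ [hd xs]) ! a = xs ! b" by (simp add: nth_append nth_tl)
      then show False using no_arc[of a] ab e by (auto simp: doubleton_eq_iff)
    qed
    moreover have "\<not> (a = 0 \<and> Suc b = length xs)"
    proof
      assume "a = 0 \<and> Suc b = length xs"
      then have "(tl xs @ [hd xs]) ! b = xs ! a" using \<open>xs \<noteq> []\<close> by (auto simp: nth_append hd_conv_nth)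
      then show False using no_arc[of b] ab e by (auto simp: doubleton_eq_iff)
    qed
    ultimately show ?thesis using ab by linarith
  qed
  have "i \<noteq> j" using uv(3) ij adj_not_same by blast
  then show "\<exists>i j. Suc i < j \<and> j < length xs \<and> \<not> (i = 0 \<and> Suc j = length xs) \<and> adj (xs ! i) (xs ! j)"
  proof (cases "i < j")
    case True
    then show ?thesis using chord[of i j] ij uv(3) by (intro exI[of _ i] exI[of _ j]) auto
  next
    case False
    then have "j < i" using \<open>i \<noteq> j\<close> by simp
    moreover have "adj (xs ! j) (xs ! i)" using uv(3) ij graph_symmetric by simp
    ultimately show ?thesis using chord[of j i] ij
      by (intro exI[of _ j] exI[of _ i]) (auto simp: insert_commute)
  qed
qed

text \<open>Connectedness of a digraph is defined through its symmetric closure. As G is symmetric,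
  each step in that closure is an edge of G inside U.\<close>

lemma conn_induced:
  assumes "connected (G \<restriction> U)" "U \<subseteq> verts G" shows "U.conn U"
proof -
  let ?H = "mk_symmetric (G \<restriction> U)"
  have ends: "adj (tail G e) (head G e)" "adj (head G e) (tail G e)" if "e \<in> arcs G" for e
    using in_arcs_imp_in_arcs_ends[OF that] graph_symmetric by blast+
  have edge: "adj y z \<and> y \<in> U \<and> z \<in> U" if "(y, z) \<in> parcs ?H" for y z
    using that by (auto simp: parcs_mk_symmetric induce_subgraph_def intro: ends)
  show ?thesis unfolding U.conn_def
  proof (intro ballI)
    fix x y assume xy: "x \<in> U" "y \<in> U"
    have "x \<rightarrow>\<^sup>*\<^bsub>?H\<^esub> y"
      using assms(1) xy by (auto simp: connected_def strongly_connected_def)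
    then have "(x, y) \<in> rtrancl_on U (parcs ?H)" by (simp add: reachable_def)
    then show "U.reach U x y"
    proof (induction rule: rtrancl_on_induct)
      case base
      then show ?case by (rule U.reach_refl)
    next
      case (step y z)
      then show ?case using edge[of y z] U.reach_step[of y U z] U.reach_trans by blast
    qed
  qed
qed

end

theorem theorem3p9:
  fixes G :: "('a, 'b) pre_digraph" and n :: nat
  assumes "graph G"
    and "card (verts G) = n"
    and "k_connected 2 G"
    and "chordal G"
  shows "int (lct G) \<le> 4 * (1 + \<lfloor>log 2 (real n)\<rfloor>)"
proof -
  interpret graph G by (rule assms(1))
  interpret U: ugraph "verts G" adj by (rule ugraph_adj)
  have n: "2 < n" and con: "\<And>S. S \<subseteq> verts G \<Longrightarrow> card S < 2 \<Longrightarrow> connected (G \<restriction> (verts G - S))"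
    using assms(2,3) by (auto simp: k_connected_def)
  have conn_V: "U.conn (verts G)"
    using conn_induced[OF con[of "{}"]] by simp
  have conn_remove: "U.conn (verts G - {z})" for z
  proof (cases "z \<in> verts G")
    case True
    then show ?thesis using conn_induced[OF con[of "{z}"]] by auto
  next
    case False
    then show ?thesis using conn_V by simp
  qed
  interpret C: two_connected_chordal_ugraph "verts G" adj
    using chordal_ugraph_adj[OF assms(4)] conn_V conn_remove
    by (simp add: two_connected_chordal_ugraph_def two_connected_chordal_ugraph_axioms_def)
  \<comment> \<open>This is the least exponent with \<open>n < 2 ^ k\<close>.\<close>
  define k where "k = nat (1 + \<lfloor>log 2 (real n)\<rfloor>)"
  have fl: "0 \<le> \<lfloor>log 2 (real n)\<rfloor>" using n by simp
  then have k: "int k = 1 + \<lfloor>log 2 (real n)\<rfloor>" by (simp add: k_def)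
  then have "log 2 (real n) < real k" by linarith
  then have "real n < 2 ^ k" using n by (simp add: log_less_iff powr_realpow)
  then have "real n < real (2 ^ k)" by simp
  then have "card (verts G) < 2 ^ k" using assms(2) by (simp only: of_nat_less_iff)
  moreover have "verts G \<noteq> {}" using assms(2) n by auto
  ultimately obtain S where S: "S \<subseteq> verts G" "card S \<le> 4 * k"
    "\<And>xs. U.longest xs \<Longrightarrow> set xs \<inter> S \<noteq> {}"
    using C.longest_cycle_transversal_log by blast
  have "longest_cycle_transversal G S"
    unfolding longest_cycle_transversal_def
  proof (intro conjI allI impI)
    fix p assume p: "longest_cycle G p"
    \<comment> \<open>Passing between arc lists and lists of tails preserves length, so maximality
      carries over to vertex lists.\<close>
    have "U.longest (map (tail G) p)" unfolding U.longest_def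
    proof (intro conjI allI impI)
      show "U.is_cycle (map (tail G) p)" using p is_cycle_tails by (simp add: longest_cycle_def)
      fix ys assume "U.is_cycle ys"
      then obtain q where "graph_cycle G q" "map (tail G) q = ys" by (rule graph_cycle_of_is_cycle)
      then show "length ys \<le> length (map (tail G) p)" using p by (auto simp: longest_cycle_def)
    qed
    from S(3)[OF this] show "S \<inter> cycle_verts G p \<noteq> {}" by (simp add: cycle_verts_def Int_commute)
  qed (rule S(1))
  then have "lct G \<le> card S" unfolding lct_def by (intro Least_le) blast
  then have "lct G \<le> 4 * k" using S(2) by simp
  then have "int (lct G) \<le> int (4 * k)" by (rule iffD2[OF of_nat_le_iff])
  then show ?thesis using k by simp
qed

end
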